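(* Let $1\le p<\infty$. (Vilenkin case) If $f\in L_p(G_m)$, then $\|\sigma_n^\psi f-f\|_p\to 0$ as $n\to\infty$. (Trigonometric case) If $f\in L_p([-\pi,\pi])$, then $\|\sigma_n^T f-f\|_p\to 0$ as $n\to\infty$.
   Context: $\mathbb{N}_+$ is the set of positive integers and $\mathbb{N}=\mathbb{N}_+\cup\{0\}$. Vilenkin system. Let $m=(m_0,m_1,\dots)$ be a bounded sequence of integers, $m_k\ge 2$. $G_m$ is the complete direct product of the additive groups $Z_{m_k}=\{0,1,\dots,m_k-1\}$ of integers modulo $m_k$, with the product of the discrete topologies; its elements are sequences $x=(x_0,x_1,\dots)$ with $x_k\in Z_{m_k}$. $\mu$ is the normalized Haar measure on $G_m$ (the product of the uniform probability measures on $Z_{m_k}$). Put $M_0=1$, $M_{k+1}=m_kM_k$; every $n\in\mathbb{N}$ is uniquely $n=\sum_{j\ge 0}n_jM_j$ with $n_j\in Z_{m_j}$, only finitely many $n_j$ nonzero. Let $r_k(x)=\exp(2\pi \imath x_k/m_k)$, $\imath^2=-1$, and $\psi_n(x)=\prod_{k\ge 0}r_k(x)^{n_k}$, $n\in\mathbb{N}$. For $f\in L_1(G_m)$: $\widehat f^\psi(k)=\int_{G_m} f\,\overline{\psi_k}\,d\mu$; $S_0^\psi f=0$, $S_n^\psi f=\sum_{k=0}^{n-1}\widehat f^\psi(k)\psi_k$; $\sigma_n^\psi f=\frac1n\sum_{k=0}^{n-1}S_k^\psi f$ for $n\in\mathbb{N}_+$. Trigonometric system. On $[-\pi,\pi]$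 let $d\mu=dx/(2\pi)$. For $f\in L_1([-\pi,\pi])$: $\widehat f^T(j)=\int_{[-\pi,\pi]}f(x)e^{-\imath jx}\,d\mu(x)$ for $j\in\mathbb{Z}$; $S_k^Tf(x)=\sum_{|j|\le k}\widehat f^T(j)e^{\imath jx}$ for $k\in\mathbb{N}$; $\sigma_n^Tf=\frac1n\sum_{k=0}^{n-1}S_k^Tf$ for $n\in\mathbb{N}_+$. Equivalently, $\sigma_n^Tf$ is the convolution of $f$ (extended $2\pi$-periodically) with $K_n^T(x)=\frac1n\left(\frac{\sin(nx/2)}{\sin(x/2)}\right)^2$ with respect to $\mu$. $\|\cdot\|_p$ is the $L_p$ norm with respect to $\mu$. *)

theory Defs
  imports "HOL-Probability.Probability"
begin

text \<open>
  The library's Bochner integral of a non-integrable function is 0, so the norm is defined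
  by the nonnegative integral and is \<open>\<infinity>\<close> outside of \<open>L\<^sub>p\<close>. It is meant for \<open>1 \<le> p\<close>.
  Functions are not identified up to null sets.
\<close>

definition Lp_norm :: "'a measure \<Rightarrow> real \<Rightarrow> ('a \<Rightarrow> complex) \<Rightarrow> ennreal" where
  "Lp_norm M p f =
     (let I = (\<integral>\<^sup>+ x. ennreal (norm (f x) powr p) \<partial>M)
      in if I = \<infinity> then \<infinity> else ennreal (enn2real I powr (1 / p)))"

definition Lp :: "'a measure \<Rightarrow> real \<Rightarrow> ('a \<Rightarrow> complex) set" where
  "Lp M p = {f \<in> borel_measurable M. Lp_norm M p f < \<infinity>}"


text \<open>
  The residues modulo \<open>m k\<close> are \<open>{..<m k}\<close>. The space of this measure is \<open>G\<^sub>m\<close>, and its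
  \<open>\<sigma>\<close>-algebra, the product of the discrete ones, is the Borel \<open>\<sigma>\<close>-algebra of \<open>G\<^sub>m\<close>.
\<close>

definition vilenkin_measure :: "(nat \<Rightarrow> nat) \<Rightarrow> (nat \<Rightarrow> nat) measure" where
  "vilenkin_measure m = (\<Pi>\<^sub>M k\<in>UNIV. uniform_count_measure {..<m k})"

definition vilenkin_M :: "(nat \<Rightarrow> nat) \<Rightarrow> nat \<Rightarrow> nat" where
  "vilenkin_M m k = (\<Prod>i<k. m i)"

definition vilenkin_digit :: "(nat \<Rightarrow> nat) \<Rightarrow> nat \<Rightarrow> nat \<Rightarrow> nat" where
  "vilenkin_digit m n j = (n div vilenkin_M m j) mod m j"

lemma vilenkin_M_simps [simp]:
  "vilenkin_M m 0 = 1"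
  "vilenkin_M m (Suc k) = m k * vilenkin_M m k"
  by (simp_all add: vilenkin_M_def)

lemma vilenkin_M_gt:
  assumes "\<And>k. 2 \<le> m k"
  shows "k < vilenkin_M m k"
proof (induction k)
  case (Suc k)
  have "Suc k < 2 * vilenkin_M m k" using Suc by simp
  also have "\<dots> \<le> m k * vilenkin_M m k" using assms[of k] by (rule mult_le_mono1)
  finally show ?case by simp
qed simp

lemma vilenkin_digit_less:
  assumes "\<And>k. 2 \<le> m k"
  shows "vilenkin_digit m n j < m j"
  using assms[of j] by (simp add: vilenkin_digit_def)

lemma vilenkin_digit_eq_0:
  assumes "\<And>k. 2 \<le> m k" and "n \<le> j"
  shows "vilenkin_digit m n j = 0"
  using vilenkin_M_gt[of m j, OF assms(1)] assms(2) by (simp add: vilenkin_digit_def)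

lemma finite_vilenkin_digit:
  assumes "\<And>k. 2 \<le> m k"
  shows "finite {j. vilenkin_digit m n j \<noteq> 0}"
  by (rule finite_subset[of _ "{..<n}"])
     (use vilenkin_digit_eq_0[of m, OF assms] in \<open>auto intro: not_le_imp_less\<close>)

lemma vilenkin_expansion_mod:
  "(\<Sum>j<k. vilenkin_digit m n j * vilenkin_M m j) = n mod vilenkin_M m k"
proof (induction k)
  case (Suc k)
  have "n mod (vilenkin_M m k * m k) =
      vilenkin_M m k * (n div vilenkin_M m k mod m k) + n mod vilenkin_M m k"
    by (rule mod_mult2_eq)
  then show ?case using Suc by (simp add: vilenkin_digit_def mult.commute)
qed simp

lemma vilenkin_expansion:
  assumes "\<And>k. 2 \<le> m k"
  shows "n = (\<Sum>j | vilenkin_digit m n j \<noteq> 0. vilenkin_digit m n j * vilenkin_M m j)"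
proof -
  have "(\<Sum>j | vilenkin_digit m n j \<noteq> 0. vilenkin_digit m n j * vilenkin_M m j) =
      (\<Sum>j<n. vilenkin_digit m n j * vilenkin_M m j)"
    by (rule sum.mono_neutral_left)
       (use vilenkin_digit_eq_0[of m, OF assms] in \<open>auto intro: not_le_imp_less\<close>)
  also have "\<dots> = n"
    using vilenkin_M_gt[of m n, OF assms] by (simp add: vilenkin_expansion_mod)
  finally show ?thesis by (rule sym)
qed

lemma vilenkin_expansion_less:
  assumes "\<And>j. d j < m j"
  shows "(\<Sum>j<k. d j * vilenkin_M m j) < vilenkin_M m k"
proof (induction k)
  case (Suc k)
  have "(\<Sum>j<Suc k. d j * vilenkin_M m j) < Suc (d k) * vilenkin_M m k"
    using Suc by simp
  also have "\<dots> \<le> m k * vilenkin_M m k"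
    using assms[of k] by (intro mult_le_mono1) simp
  finally show ?case by simp
qed simp

lemma vilenkin_digit_unique:
  assumes d: "\<And>j. d j < m j" and fin: "finite {j. d j \<noteq> 0}"
    and n: "n = (\<Sum>j | d j \<noteq> 0. d j * vilenkin_M m j)"
  shows "d = vilenkin_digit m n"
proof
  fix i
  from fin obtain b where b: "{j. d j \<noteq> 0} \<subseteq> {..<b}"
    using finite_nat_bounded by blast
  define N where "N = b + Suc i"
  have sum_N: "n = (\<Sum>j<N. d j * vilenkin_M m j)"
    unfolding n by (rule sum.mono_neutral_left) (use b in \<open>auto simp: N_def\<close>)
  have "vilenkin_M m (Suc i) dvd (\<Sum>j\<in>{Suc i..<N}. d j * vilenkin_M m j)"
  proof (rule dvd_sum)
    fix j assume "j \<in> {Suc i..<N}"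
    then have "vilenkin_M m (Suc i) dvd vilenkin_M m j"
      unfolding vilenkin_M_def by (intro prod_dvd_prod_subset) auto
    then show "vilenkin_M m (Suc i) dvd d j * vilenkin_M m j" by simp
  qed
  then obtain q where
    q: "(\<Sum>j\<in>{Suc i..<N}. d j * vilenkin_M m j) = vilenkin_M m (Suc i) * q" by blast
  have "n = (\<Sum>j<Suc i. d j * vilenkin_M m j) + (\<Sum>j\<in>{Suc i..<N}. d j * vilenkin_M m j)"
    unfolding sum_N lessThan_atLeast0 by (rule sum.atLeastLessThan_concat[symmetric])
      (auto simp: N_def)
  then have n_eq: "n = (\<Sum>j<i. d j * vilenkin_M m j) + vilenkin_M m i * (d i + m i * q)"
    unfolding q by (simp add: algebra_simps)
  have less: "(\<Sum>j<i. d j * vilenkin_M m j) < vilenkin_M m i"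
    using d by (rule vilenkin_expansion_less)
  have "n div vilenkin_M m i = d i + m i * q"
    unfolding n_eq using less by simp
  then show "d i = vilenkin_digit m n i"
    using d[of i] by (simp add: vilenkin_digit_def)
qed

definition vilenkin_r :: "(nat \<Rightarrow> nat) \<Rightarrow> nat \<Rightarrow> (nat \<Rightarrow> nat) \<Rightarrow> complex" where
  "vilenkin_r m k x = exp (2 * of_real pi * \<i> * of_nat (x k) / of_nat (m k))"

definition vilenkin_psi :: "(nat \<Rightarrow> nat) \<Rightarrow> nat \<Rightarrow> (nat \<Rightarrow> nat) \<Rightarrow> complex" where
  "vilenkin_psi m n x =
     (\<Prod>k | vilenkin_digit m n k \<noteq> 0. vilenkin_r m k x ^ vilenkin_digit m n k)"

definition vilenkin_coeff :: "(nat \<Rightarrow> nat) \<Rightarrow> ((nat \<Rightarrow> nat) \<Rightarrow> complex) \<Rightarrow> nat \<Rightarrow> complex" where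
  "vilenkin_coeff m f k = (\<integral>x. f x * cnj (vilenkin_psi m k x) \<partial>vilenkin_measure m)"

definition vilenkin_S ::
  "(nat \<Rightarrow> nat) \<Rightarrow> nat \<Rightarrow> ((nat \<Rightarrow> nat) \<Rightarrow> complex) \<Rightarrow> (nat \<Rightarrow> nat) \<Rightarrow> complex" where
  "vilenkin_S m n f x = (\<Sum>k<n. vilenkin_coeff m f k * vilenkin_psi m k x)"

definition vilenkin_sigma ::
  "(nat \<Rightarrow> nat) \<Rightarrow> nat \<Rightarrow> ((nat \<Rightarrow> nat) \<Rightarrow> complex) \<Rightarrow> (nat \<Rightarrow> nat) \<Rightarrow> complex" where
  "vilenkin_sigma m n f x = (1 / of_nat n) * (\<Sum>k<n. vilenkin_S m k f x)"


definition trig_measure :: "real measure" where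
  "trig_measure = density (lebesgue_on {-pi..pi}) (\<lambda>x. ennreal (1 / (2 * pi)))"

definition trig_coeff :: "(real \<Rightarrow> complex) \<Rightarrow> int \<Rightarrow> complex" where
  "trig_coeff f j = (\<integral>x. f x * exp (- (\<i> * of_int j * of_real x)) \<partial>trig_measure)"

definition trig_S :: "nat \<Rightarrow> (real \<Rightarrow> complex) \<Rightarrow> real \<Rightarrow> complex" where
  "trig_S k f x = (\<Sum>j\<in>{- int k..int k}. trig_coeff f j * exp (\<i> * of_int j * of_real x))"

definition trig_sigma :: "nat \<Rightarrow> (real \<Rightarrow> complex) \<Rightarrow> real \<Rightarrow> complex" where
  "trig_sigma n f x = (1 / of_nat n) * (\<Sum>k<n. trig_S k f x)"

end

theory Submission
  imports Defs
begin

text \<open>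
  The means are integral operators with a kernel \<open>K\<^sub>n\<close> whose modulus is symmetric. If
  \<open>\<integral>\<bar>K\<^sub>n(x, y)\<bar> dy \<le> C\<close> uniformly in \<open>n\<close> and \<open>x\<close>, then by Schur's test they are uniformly bounded
  on \<open>L\<^sub>p\<close>, so the functions whose means converge in \<open>L\<^sub>p\<close> form a closed subspace. It is all of
  \<open>L\<^sub>p\<close> once it contains the indicators of a generating \<open>\<pi>\<close>-system.

  Vilenkin case: indicators of cylinder sets are combinations of finitely many \<open>\<psi>\<^sub>j\<close>. For the
  bound on \<open>F\<^sub>n = n K\<^sub>n\<close>, the relation \<open>\<psi>\<^sub>q\<^sub>M\<^sub>+\<^sub>s = r\<^sub>A\<^sup>q \<psi>\<^sub>s\<close> for \<open>M = M\<^sub>A\<close>, \<open>q < m\<^sub>A\<close>, \<open>s < M\<close> gives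
  \<open>\<parallel>F\<^sub>q\<^sub>M\<^sub>+\<^sub>s\<parallel> \<le> \<parallel>F\<^sub>q\<^sub>M\<parallel> + s \<parallel>D\<^sub>q\<^sub>M\<parallel> + \<parallel>F\<^sub>s\<parallel>\<close>, so that digit by digit everything reduces to
  \<open>\<parallel>F\<^sub>M\<parallel> = O(M)\<close>. In passing from \<open>A\<close> to \<open>A + 1\<close> the kernel \<open>F\<^sub>M\<close> is multiplied by
  \<open>\<Sum>\<^sub>l r\<^sub>A\<^sup>l\<close>, which is \<open>m\<^sub>A\<close> times the indicator of \<open>x\<^sub>A = 0\<close>; as \<open>F\<^sub>M\<close> depends only on the
  coordinates before \<open>A\<close>, independence shows that this factor preserves its \<open>L\<^sub>1\<close> norm.

  Trigonometric case: the Fejer kernel is nonnegative with integral 1, and it tends to 0 uniformly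
  away from the diagonal, so for the indicator of a half-line the means converge almost everywhere
  and boundedly.
\<close>

section \<open>Means given by kernels\<close>

lemma borel_measurable_cnj [measurable]:
  "f \<in> borel_measurable M \<Longrightarrow> (\<lambda>x. cnj (f x)) \<in> borel_measurable M"
  by (rule borel_measurable_continuous_on) (intro continuous_intros)

section \<open>Powers of the norm in place of the norm\<close>

text \<open>The \<open>p\<close>-th power of the norm. To prove convergence to 0 it can replace the
  norm, and a triangle inequality up to a constant factor is then enough.\<close>

definition Lp_pow :: "'a measure \<Rightarrow> real \<Rightarrow> ('a \<Rightarrow> complex) \<Rightarrow> ennreal" where
  "Lp_pow M p f = (\<integral>\<^sup>+ x. ennreal (norm (f x) powr p) \<partial>M)"

lemma Lp_iff: "f \<in> Lp M p \<longleftrightarrow> f \<in> borel_measurable M \<and> Lp_pow M p f < \<infinity>"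
  by (auto simp: Lp_def Lp_norm_def Lp_pow_def Let_def less_top)

text \<open>Once the \<open>p\<close>-th power drops below 1 it is finite, which excludes the
  infinite branch of \<open>Lp_norm\<close>; the root is continuous at 0.\<close>

lemma Lp_norm_tendsto_0:
  assumes p: "0 < p" and lim: "(\<lambda>n. Lp_pow M p (g n)) \<longlonglongrightarrow> 0"
  shows "(\<lambda>n. Lp_norm M p (g n)) \<longlonglongrightarrow> 0"
proof -
  have "\<forall>\<^sub>F n in sequentially. Lp_pow M p (g n) < 1"
    using lim by (rule order_tendstoD) simp
  then have ev: "\<forall>\<^sub>F n in sequentially.
      ennreal (enn2real (Lp_pow M p (g n)) powr (1 / p)) = Lp_norm M p (g n)"
    by eventually_elim (auto simp: Lp_norm_def Lp_pow_def Let_def)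
  have "(\<lambda>n. enn2real (Lp_pow M p (g n))) \<longlonglongrightarrow> 0"
    using lim by (intro tendsto_enn2real) auto
  then have "(\<lambda>n. enn2real (Lp_pow M p (g n)) powr (1 / p)) \<longlonglongrightarrow> 0"
    using p by (intro tendsto_zero_powrI[OF _ tendsto_const]) auto
  then have "(\<lambda>n. ennreal (enn2real (Lp_pow M p (g n)) powr (1 / p))) \<longlonglongrightarrow> ennreal 0"
    by (rule tendsto_ennrealI)
  then show ?thesis using Lim_transform_eventually[OF _ ev] by simp
qed

text \<open>The norm of a sum is at most twice the larger norm, whose power is one of the two
  summands.\<close>

lemma norm_add_powr_le:
  fixes a b :: "'a::real_normed_vector"
  assumes "0 \<le> p"
  shows "norm (a + b) powr p \<le> 2 powr p * (norm a powr p + norm b powr p)"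
proof -
  have "norm (a + b) powr p \<le> (2 * max (norm a) (norm b)) powr p"
    using norm_triangle_ineq[of a b] assms by (intro powr_mono2) auto
  also have "\<dots> = 2 powr p * max (norm a) (norm b) powr p"
    by (intro powr_mult) 
  also have "\<dots> \<le> 2 powr p * (norm a powr p + norm b powr p)"
    by (intro mult_left_mono) (auto simp: max_def)
  finally show ?thesis .
qed

lemma Lp_pow_add_le:
  assumes p: "0 \<le> p" and [measurable]: "f \<in> borel_measurable M" "g \<in> borel_measurable M"
  shows "Lp_pow M p (\<lambda>x. f x + g x) \<le> ennreal (2 powr p) * (Lp_pow M p f + Lp_pow M p g)"
proof -
  have "Lp_pow M p (\<lambda>x. f x + g x) \<le>
      (\<integral>\<^sup>+ x. ennreal (2 powr p) * (ennreal (norm (f x) powr p) + ennreal (norm (g x) powr p)) \<partial>M)"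
    unfolding Lp_pow_def
    by (intro nn_integral_mono)
       (simp add: ennreal_mult'[symmetric] norm_add_powr_le[OF p] flip: ennreal_plus)
  also have "\<dots> = ennreal (2 powr p) * (Lp_pow M p f + Lp_pow M p g)"
    unfolding Lp_pow_def by (simp add: nn_integral_cmult nn_integral_add)
  finally show ?thesis .
qed

lemma Lp_pow_cmult:
  assumes [measurable]: "f \<in> borel_measurable M"
  shows "Lp_pow M p (\<lambda>x. c * f x) = ennreal (norm c powr p) * Lp_pow M p f"
  by (simp add: Lp_pow_def norm_mult powr_mult ennreal_mult' nn_integral_cmult)

lemma Lp_pow_cong_AE:
  assumes "AE x in M. f x = g x"
  shows "Lp_pow M p f = Lp_pow M p g"
  unfolding Lp_pow_def using assms by (intro nn_integral_cong_AE) auto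

lemma Lp_pow_minus: "Lp_pow M p (\<lambda>x. - f x) = Lp_pow M p f"
  by (simp add: Lp_pow_def)

lemma Lp_add:
  assumes "0 \<le> p" "f \<in> Lp M p" "g \<in> Lp M p"
  shows "(\<lambda>x. f x + g x) \<in> Lp M p"
  using Lp_pow_add_le[of p f M g] assms
  by (auto simp: Lp_iff ennreal_mult_less_top order_le_less_trans)

lemma Lp_cmult: "f \<in> Lp M p \<Longrightarrow> (\<lambda>x. c * f x) \<in> Lp M p"
  by (auto simp: Lp_iff Lp_pow_cmult ennreal_mult_less_top)

lemma Lp_diff:
  assumes "0 \<le> p" "f \<in> Lp M p" "g \<in> Lp M p"
  shows "(\<lambda>x. f x - g x) \<in> Lp M p"
  using Lp_add[OF assms(1,2) Lp_cmult[OF assms(3), of "-1"]] by simp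

lemma (in finite_measure) bounded_Lp:
  assumes "0 \<le> p" and [measurable]: "f \<in> borel_measurable M"
    and "\<And>x. x \<in> space M \<Longrightarrow> norm (f x) \<le> B"
  shows "f \<in> Lp M p"
proof -
  have "Lp_pow M p f \<le> (\<integral>\<^sup>+ x. ennreal (B powr p) \<partial>M)"
    unfolding Lp_pow_def using assms by (intro nn_integral_mono ennreal_leI powr_mono2) auto
  also have "\<dots> < \<infinity>" by (simp add: ennreal_mult_less_top emeasure_eq_measure)
  finally show ?thesis by (simp add: Lp_iff)
qed

section \<open>Jensen's inequality\<close>

text \<open>The tangent to \<open>v powr p\<close> at \<open>v = 1\<close>. It follows from the
  weighted inequality of arithmetic and geometric means for \<open>v powr p\<close> and 1, with
  weights \<open>1 / p\<close> and \<open>1 - 1 / p\<close>.\<close>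

lemma powr_ge_tangent_at_1:
  fixes p v :: real
  assumes p: "1 \<le> p" and v: "0 \<le> v"
  shows "p * v \<le> v powr p + (p - 1)"
proof (cases "v = 0")
  case False
  then have "(v powr p) powr (1 / p) * 1 powr (1 - 1 / p) \<le> (1 / p) * v powr p + (1 - 1 / p) * 1"
    using p v by (intro Youngs_inequality_0) auto
  then have "v \<le> (1 / p) * v powr p + (1 - 1 / p)"
    using p v False by (simp add: powr_powr)
  then have "p * v \<le> p * ((1 / p) * v powr p + (1 - 1 / p))"
    using p by (intro mult_left_mono) auto
  also have "\<dots> = v powr p + (p - 1)" using p by (simp add: field_simps)
  finally show ?thesis .
qed (use p in auto)

text \<open>By the tangent inequality the norm is at most its \<open>p\<close>-th power plus a
  constant, and constants are integrable for a finite measure.\<close>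

lemma (in finite_measure) Lp_integrable:
  assumes p: "1 \<le> p" and f: "f \<in> Lp M p"
  shows "integrable M f"
proof (rule integrableI_bounded)
  show "f \<in> borel_measurable M" using f by (simp add: Lp_iff)
  then have [measurable]: "f \<in> borel_measurable M" .
  have le: "norm (f x) \<le> norm (f x) powr p + p" for x
  proof -
    have "norm (f x) \<le> p * norm (f x)" using p by (simp add: mult_le_cancel_right1)
    also have "\<dots> \<le> norm (f x) powr p + (p - 1)" using powr_ge_tangent_at_1[OF p, of "norm (f x)"] by simp
    finally show ?thesis by simp
  qed
  have "(\<integral>\<^sup>+ x. ennreal (norm (f x)) \<partial>M) \<le> (\<integral>\<^sup>+ x. ennreal (norm (f x) powr p) + ennreal p \<partial>M)"
    using le p by (intro nn_integral_mono) (simp flip: ennreal_plus)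
  also have "\<dots> = Lp_pow M p f + ennreal p * emeasure M (space M)"
    by (simp add: nn_integral_add Lp_pow_def)
  also have "\<dots> < \<infinity>"
    using f by (simp add: Lp_iff ennreal_mult_less_top emeasure_eq_measure)
  finally show "(\<integral>\<^sup>+ x. ennreal (norm (f x)) \<partial>M) < \<infinity>" .
qed

text \<open>Jensen's inequality for the unnormalised weight \<open>k\<close>: integrate the tangent line inequality
  for \<open>t \<mapsto> t powr p\<close> at the point \<open>(\<integral>h k) / C\<close>.\<close>

lemma weighted_powr_integral_le:
  fixes h k :: "'a \<Rightarrow> real"
  assumes p: "1 \<le> p" and C: "0 < C"
    and h: "\<And>x. 0 \<le> h x" and k: "\<And>x. 0 \<le> k x"
    and int: "integrable M (\<lambda>x. h x * k x)" "integrable M (\<lambda>x. h x powr p * k x)" "integrable M k"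
    and le: "(\<integral>x. k x \<partial>M) \<le> C"
  shows "(\<integral>x. h x * k x \<partial>M) powr p \<le> C powr (p - 1) * (\<integral>x. h x powr p * k x \<partial>M)"
proof -
  define I where "I = (\<integral>x. h x * k x \<partial>M)"
  define J where "J = (\<integral>x. h x powr p * k x \<partial>M)"
  define s where "s = I / C"
  have I0: "0 \<le> I" unfolding I_def using h k by (intro integral_nonneg_AE) auto
  have J0: "0 \<le> J" unfolding J_def using h k by (intro integral_nonneg_AE) auto
  show ?thesis
  proof (cases "I = 0")
    case True
    then show ?thesis using J0 by (simp add: I_def[symmetric] J_def[symmetric])
  next
    case False
    with I0 C have s: "0 < s" by (simp add: s_def)
    \<comment> \<open>The tangent at 1 rescaled: it is applied to \<open>h x / s\<close> and
      multiplied by \<open>s powr p\<close>.\<close>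
    have tangent: "p * s powr (p - 1) * h x \<le> h x powr p + (p - 1) * s powr p" for x
    proof -
      have "s powr p * (p * (h x / s)) \<le> s powr p * ((h x / s) powr p + (p - 1))"
        using s h[of x] p by (intro mult_left_mono powr_ge_tangent_at_1) auto
      moreover have "s powr p * (p * (h x / s)) = p * s powr (p - 1) * h x"
        using s by (simp add: powr_diff field_simps)
      moreover have "s powr p * ((h x / s) powr p + (p - 1)) = h x powr p + (p - 1) * s powr p"
        using s h[of x] by (simp add: powr_divide field_simps)
      ultimately show ?thesis by simp
    qed
    have "(\<integral>x. p * s powr (p - 1) * (h x * k x) \<partial>M) \<le>
        (\<integral>x. h x powr p * k x + (p - 1) * s powr p * k x \<partial>M)"
    proof (rule integral_mono)
      show "integrable M (\<lambda>x. p * s powr (p - 1) * (h x * k x))"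
        by (intro integrable_mult_right int)
      show "integrable M (\<lambda>x. h x powr p * k x + (p - 1) * s powr p * k x)"
        by (intro Bochner_Integration.integrable_add integrable_mult_right int)
      show "p * s powr (p - 1) * (h x * k x) \<le> h x powr p * k x + (p - 1) * s powr p * k x" for x
        using mult_right_mono[OF tangent k, of x x] by (simp add: algebra_simps)
    qed
    then have "p * s powr (p - 1) * I \<le> J + (p - 1) * s powr p * (\<integral>x. k x \<partial>M)"
      using int by (simp add: I_def J_def)
    also have "\<dots> \<le> J + (p - 1) * s powr p * C"
      using p le by (intro add_left_mono mult_left_mono) auto
    finally have "p * s powr (p - 1) * I \<le> J + (p - 1) * s powr p * C" .
    \<comment> \<open>As \<open>I = s * C\<close>, subtracting \<open>(p - 1) * s powr p * C\<close>
      from both sides leaves \<open>s powr p * C \<le> J\<close>.\<close>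
    moreover have "p * s powr (p - 1) * I = p * s powr p * C"
      using s C by (simp add: powr_diff s_def field_simps)
    ultimately have "s powr p * C \<le> J" by (simp add: left_diff_distrib)
    then have "C powr (p - 1) * (s powr p * C) \<le> C powr (p - 1) * J"
      by (intro mult_left_mono) auto
    moreover have "C powr (p - 1) * (s powr p * C) = I powr p"
      using C I0 by (simp add: s_def powr_divide powr_diff)
    ultimately show ?thesis by (simp add: I_def J_def)
  qed
qed

section \<open>Integral operators and Schur's test\<close>

text \<open>The bound in \<open>kernel_bounded\<close> may depend on \<open>n\<close> and only
  secures integrability; the uniform estimate is \<open>kernel_L1\<close>. Symmetry of the modulus
  transfers it to the other variable.\<close>

locale kernel_means = prob_space M for M :: "'a measure" +
  fixes K :: "nat \<Rightarrow> 'a \<Rightarrow> 'a \<Rightarrow> complex" and p C :: real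
  assumes p_ge_1: "1 \<le> p" and C_pos: "0 < C"
    and kernel_measurable: "(\<lambda>(x, y). K n x y) \<in> borel_measurable (M \<Otimes>\<^sub>M M)"
    and kernel_bounded: "\<exists>B. \<forall>x\<in>space M. \<forall>y\<in>space M. norm (K n x y) \<le> B"
    and kernel_sym: "norm (K n x y) = norm (K n y x)"
    and kernel_L1: "x \<in> space M \<Longrightarrow> (\<integral>y. norm (K n x y) \<partial>M) \<le> C"
begin

definition T :: "nat \<Rightarrow> ('a \<Rightarrow> complex) \<Rightarrow> 'a \<Rightarrow> complex" where
  "T n f x = (\<integral>y. f y * K n x y \<partial>M)"

lemma kernel_measurable' [measurable]:
  "(\<lambda>z. K n (fst z) (snd z)) \<in> borel_measurable (M \<Otimes>\<^sub>M M)"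
  using kernel_measurable[of n] by (simp add: case_prod_beta')

lemma kernel_measurable_snd [measurable]: "x \<in> space M \<Longrightarrow> K n x \<in> borel_measurable M"
  using measurable_compose[OF measurable_Pair1' kernel_measurable', of x n] by simp

lemma integrable_mult_kernel:
  assumes x: "x \<in> space M" and f: "integrable M f"
  shows "integrable M (\<lambda>y. f y * K n x y)"
proof -
  obtain B where B: "\<And>y. y \<in> space M \<Longrightarrow> norm (K n x y) \<le> B"
    using kernel_bounded[of n] x by blast
  have [measurable]: "f \<in> borel_measurable M" using f by simp
  have [measurable]: "K n x \<in> borel_measurable M" using x by simp
  show ?thesis
  proof (rule Bochner_Integration.integrable_bound)
    show "integrable M (\<lambda>y. B *\<^sub>R f y)" using f by simp
    show "AE y in M. norm (f y * K n x y) \<le> norm (B *\<^sub>R f y)"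
      using B by (intro AE_I2) (force simp: norm_mult mult.commute[of _ "norm (f _)"] intro!: mult_left_mono order_trans[OF _ abs_ge_self])
  qed simp
qed

lemma T_measurable [measurable]:
  assumes [measurable]: "f \<in> borel_measurable M"
  shows "T n f \<in> borel_measurable M"
  unfolding T_def by (rule borel_measurable_lebesgue_integral) (simp add: case_prod_beta')

lemma T_cong_AE:
  assumes [measurable]: "f \<in> borel_measurable M" "g \<in> borel_measurable M"
    and "AE x in M. f x = g x" and [measurable]: "x \<in> space M"
  shows "T n f x = T n g x"
  unfolding T_def using assms(3) by (intro integral_cong_AE) auto

lemma T_diff:
  assumes "integrable M f" "integrable M g" "x \<in> space M"
  shows "T n (\<lambda>x. f x - g x) x = T n f x - T n g x"
  using integrable_mult_kernel[OF assms(3,1)] integrable_mult_kernel[OF assms(3,2)]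
  by (simp add: T_def left_diff_distrib)

lemma T_add:
  assumes "integrable M f" "integrable M g" "x \<in> space M"
  shows "T n (\<lambda>x. f x + g x) x = T n f x + T n g x"
  using integrable_mult_kernel[OF assms(3,1)] integrable_mult_kernel[OF assms(3,2)]
  by (simp add: T_def distrib_right)

lemma T_cmult: "T n (\<lambda>x. c * f x) x = c * T n f x"
  by (simp add: T_def mult.assoc)

text \<open>Jensen's inequality with the weight \<open>norm (K n x y)\<close> in \<open>y\<close>,
  whose total mass is at most \<open>C\<close>.\<close>

lemma norm_T_powr_le:
  assumes f: "f \<in> Lp M p" and x: "x \<in> space M"
  shows "ennreal (norm (T n f x) powr p) \<le>
    ennreal (C powr (p - 1)) * (\<integral>\<^sup>+ y. ennreal (norm (f y) powr p) * ennreal (norm (K n x y)) \<partial>M)"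
proof -
  note f1 = Lp_integrable[OF p_ge_1 f]
  have [measurable]: "f \<in> borel_measurable M" using f by (simp add: Lp_iff)
  have "integrable M (\<lambda>y. norm (f y) powr p)"
    using f by (intro integrableI_bounded) (auto simp: Lp_iff Lp_pow_def)
  then have "integrable M (\<lambda>y. complex_of_real (norm (f y) powr p))" by simp
  from integrable_norm[OF integrable_mult_kernel[OF x this, of n]]
  have int_p: "integrable M (\<lambda>y. norm (f y) powr p * norm (K n x y))"
    by (simp add: norm_mult)
  have int_k: "integrable M (\<lambda>y. norm (K n x y))"
    using integrable_norm[OF integrable_mult_kernel[OF x, of "\<lambda>_. 1" n]] by simp
  have "norm (T n f x) \<le> (\<integral>y. norm (f y) * norm (K n x y) \<partial>M)"
    using integral_norm_bound[of M "\<lambda>y. f y * K n x y"] by (simp add: T_def norm_mult)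
  then have "norm (T n f x) powr p \<le> (\<integral>y. norm (f y) * norm (K n x y) \<partial>M) powr p"
    using p_ge_1 by (intro powr_mono2) auto
  also have "\<dots> \<le> C powr (p - 1) * (\<integral>y. norm (f y) powr p * norm (K n x y) \<partial>M)"
    using integrable_norm[OF integrable_mult_kernel[OF x f1, of n]] int_p int_k kernel_L1[OF x]
    by (intro weighted_powr_integral_le p_ge_1 C_pos) (auto simp: norm_mult)
  finally have "ennreal (norm (T n f x) powr p) \<le>
      ennreal (C powr (p - 1)) * ennreal (\<integral>y. norm (f y) powr p * norm (K n x y) \<partial>M)"
    by (simp flip: ennreal_mult')
  also have "ennreal (\<integral>y. norm (f y) powr p * norm (K n x y) \<partial>M) =
      (\<integral>\<^sup>+ y. ennreal (norm (f y) powr p * norm (K n x y)) \<partial>M)"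
    using int_p by (intro nn_integral_eq_integral[symmetric]) auto
  finally show ?thesis by (simp add: ennreal_mult')
qed

text \<open>Integrating the pointwise bound over \<open>x\<close> and exchanging the integrals
  leaves the mass of \<open>norm (K n x y)\<close> in \<open>x\<close>, which is at most
  \<open>C\<close> by symmetry and supplies the last factor of \<open>C powr p\<close>.\<close>

lemma schur_test:
  assumes f: "f \<in> Lp M p"
  shows "Lp_pow M p (T n f) \<le> ennreal (C powr p) * Lp_pow M p f"
proof -
  interpret pair_sigma_finite M M ..
  have [measurable]: "f \<in> borel_measurable M" using f by (simp add: Lp_iff)
  have L1: "(\<integral>\<^sup>+ x. ennreal (norm (K n x y)) \<partial>M) \<le> ennreal C" if y: "y \<in> space M" for y
  proof -
    have "integrable M (\<lambda>x. norm (K n y x))"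
      using integrable_norm[OF integrable_mult_kernel[OF y, of "\<lambda>_. 1" n]] by simp
    then have "(\<integral>\<^sup>+ x. ennreal (norm (K n y x)) \<partial>M) = ennreal (\<integral>x. norm (K n y x) \<partial>M)"
      by (intro nn_integral_eq_integral) auto
    also have "\<dots> \<le> ennreal C" using kernel_L1[OF y] by (rule ennreal_leI)
    finally show ?thesis unfolding kernel_sym[of n y] .
  qed
  have "Lp_pow M p (T n f) \<le> (\<integral>\<^sup>+ x. ennreal (C powr (p - 1)) *
      (\<integral>\<^sup>+ y. ennreal (norm (f y) powr p) * ennreal (norm (K n x y)) \<partial>M) \<partial>M)"
    unfolding Lp_pow_def by (intro nn_integral_mono norm_T_powr_le f)
  also have "\<dots> = ennreal (C powr (p - 1)) *
      (\<integral>\<^sup>+ x. (\<integral>\<^sup>+ y. ennreal (norm (f y) powr p) * ennreal (norm (K n x y)) \<partial>M) \<partial>M)"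
    by (rule nn_integral_cmult) (simp add: case_prod_beta')
  also have "(\<integral>\<^sup>+ x. (\<integral>\<^sup>+ y. ennreal (norm (f y) powr p) * ennreal (norm (K n x y)) \<partial>M) \<partial>M) =
      (\<integral>\<^sup>+ y. (\<integral>\<^sup>+ x. ennreal (norm (f y) powr p) * ennreal (norm (K n x y)) \<partial>M) \<partial>M)"
    by (rule Fubini'[symmetric]) (simp add: case_prod_beta')
  also have "\<dots> \<le> (\<integral>\<^sup>+ y. ennreal C * ennreal (norm (f y) powr p) \<partial>M)"
  proof (rule nn_integral_mono)
    fix y assume y: "y \<in> space M"
    have "(\<integral>\<^sup>+ x. ennreal (norm (f y) powr p) * ennreal (norm (K n x y)) \<partial>M) =
        ennreal (norm (f y) powr p) * (\<integral>\<^sup>+ x. ennreal (norm (K n x y)) \<partial>M)"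
      \<comment> \<open>After the swap the integration variable is the second argument, in which
        sections of the kernel are known to be measurable.\<close>
      using y by (subst (1 2) kernel_sym) (intro nn_integral_cmult, simp)
    also have "\<dots> \<le> ennreal (norm (f y) powr p) * ennreal C"
      by (intro mult_left_mono L1 y) simp
    finally show "(\<integral>\<^sup>+ x. ennreal (norm (f y) powr p) * ennreal (norm (K n x y)) \<partial>M) \<le>
        ennreal C * ennreal (norm (f y) powr p)" by (simp add: mult.commute)
  qed
  also have "\<dots> = ennreal C * Lp_pow M p f"
    unfolding Lp_pow_def by (rule nn_integral_cmult) simp
  finally have "Lp_pow M p (T n f) \<le> ennreal (C powr (p - 1)) * (ennreal C * Lp_pow M p f)"
    by (simp add: mult_left_mono)
  also have "\<dots> = ennreal (C powr p) * Lp_pow M p f"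
    using C_pos by (simp add: mult.assoc[symmetric] powr_diff flip: ennreal_mult')
  finally show ?thesis .
qed

section \<open>The closed subspace of functions whose means converge\<close>

text \<open>Summable in the sense of summability methods, not of series: the means of
  \<open>f\<close> converge to \<open>f\<close>.\<close>

definition summable_in_Lp :: "('a \<Rightarrow> complex) \<Rightarrow> bool" where
  "summable_in_Lp f \<longleftrightarrow> f \<in> Lp M p \<and> (\<lambda>n. Lp_pow M p (\<lambda>x. T n f x - f x)) \<longlonglongrightarrow> 0"

lemma summable_in_Lp_cong_AE:
  assumes f: "summable_in_Lp f" and g [measurable]: "g \<in> borel_measurable M"
    and eq: "AE x in M. f x = g x"
  shows "summable_in_Lp g"
proof -
  have [measurable]: "f \<in> borel_measurable M" using f by (simp add: summable_in_Lp_def Lp_iff)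
  have "Lp_pow M p f = Lp_pow M p g" by (rule Lp_pow_cong_AE[OF eq])
  moreover have "Lp_pow M p (\<lambda>x. T n f x - f x) = Lp_pow M p (\<lambda>x. T n g x - g x)" for n
  proof (rule Lp_pow_cong_AE)
    show "AE x in M. T n f x - f x = T n g x - g x"
      using eq AE_space by eventually_elim (simp add: T_cong_AE[OF _ _ eq])
  qed
  ultimately show ?thesis using f by (auto simp: summable_in_Lp_def Lp_iff)
qed

lemma summable_in_Lp_add:
  assumes f: "summable_in_Lp f" and g: "summable_in_Lp g"
  shows "summable_in_Lp (\<lambda>x. f x + g x)"
proof -
  have p0: "0 \<le> p" using p_ge_1 by simp
  have Lp: "f \<in> Lp M p" "g \<in> Lp M p" using f g by (auto simp: summable_in_Lp_def)
  then have [measurable]: "f \<in> borel_measurable M" "g \<in> borel_measurable M" by (auto simp: Lp_iff)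
  have eq: "Lp_pow M p (\<lambda>x. T n (\<lambda>x. f x + g x) x - (f x + g x)) =
      Lp_pow M p (\<lambda>x. (T n f x - f x) + (T n g x - g x))" for n
    by (intro Lp_pow_cong_AE AE_I2)
       (simp add: T_add Lp_integrable[OF p_ge_1] Lp)
  have le: "Lp_pow M p (\<lambda>x. T n (\<lambda>x. f x + g x) x - (f x + g x)) \<le>
      ennreal (2 powr p) * (Lp_pow M p (\<lambda>x. T n f x - f x) + Lp_pow M p (\<lambda>x. T n g x - g x))" for n
    unfolding eq by (intro Lp_pow_add_le p0) simp_all
  have "(\<lambda>n. ennreal (2 powr p) * (Lp_pow M p (\<lambda>x. T n f x - f x) + Lp_pow M p (\<lambda>x. T n g x - g x)))
      \<longlonglongrightarrow> ennreal (2 powr p) * (0 + 0)"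
    using f g by (intro ennreal_tendsto_cmult tendsto_add) (auto simp: summable_in_Lp_def)
  then have lim: "(\<lambda>n. ennreal (2 powr p) * (Lp_pow M p (\<lambda>x. T n f x - f x) + Lp_pow M p (\<lambda>x. T n g x - g x)))
      \<longlonglongrightarrow> 0" by simp
  have "(\<lambda>n. Lp_pow M p (\<lambda>x. T n (\<lambda>x. f x + g x) x - (f x + g x))) \<longlonglongrightarrow> 0"
    by (rule tendsto_sandwich[OF _ always_eventually tendsto_const lim]) (use le in auto)
  then show ?thesis using Lp_add[OF p0 Lp] by (simp add: summable_in_Lp_def)
qed

lemma summable_in_Lp_cmult:
  assumes f: "summable_in_Lp f"
  shows "summable_in_Lp (\<lambda>x. c * f x)"
proof -
  have [measurable]: "f \<in> borel_measurable M" using f by (simp add: summable_in_Lp_def Lp_iff)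
  have "(\<lambda>n. ennreal (norm c powr p) * Lp_pow M p (\<lambda>x. T n f x - f x)) \<longlonglongrightarrow> ennreal (norm c powr p) * 0"
    using f by (intro ennreal_tendsto_cmult) (auto simp: summable_in_Lp_def)
  moreover have "Lp_pow M p (\<lambda>x. T n (\<lambda>x. c * f x) x - c * f x) =
      ennreal (norm c powr p) * Lp_pow M p (\<lambda>x. T n f x - f x)" for n
    using Lp_pow_cmult[of "\<lambda>x. T n f x - f x" M p c] by (simp add: T_cmult right_diff_distrib)
  ultimately show ?thesis using f Lp_cmult[of f M p c] by (simp add: summable_in_Lp_def)
qed

lemma summable_in_Lp_zero: "summable_in_Lp (\<lambda>x. 0)"
  using p_ge_1 by (simp add: summable_in_Lp_def T_def Lp_iff Lp_pow_def)

lemma summable_in_Lp_sum: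
  "(\<And>i. i \<in> I \<Longrightarrow> summable_in_Lp (f i)) \<Longrightarrow> summable_in_Lp (\<lambda>x. \<Sum>i\<in>I. f i x)"
  by (induction I rule: infinite_finite_induct)
     (auto intro: summable_in_Lp_add summable_in_Lp_zero)

text \<open>\<open>T n f - f\<close> splits into \<open>T n (f - g k)\<close>,
  \<open>g k - f\<close> and \<open>T n (g k) - g k\<close>. Schur's test controls the first by the
  second uniformly in \<open>n\<close>, so \<open>k\<close> is fixed first and \<open>n\<close>
  chosen afterwards.\<close>

lemma summable_in_Lp_closed:
  assumes g: "\<And>k. summable_in_Lp (g k)" and f: "f \<in> Lp M p"
    and lim: "(\<lambda>k. Lp_pow M p (\<lambda>x. g k x - f x)) \<longlonglongrightarrow> 0"
  shows "summable_in_Lp f"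
proof -
  have p0: "0 \<le> p" using p_ge_1 by simp
  have gLp: "g k \<in> Lp M p" for k using g by (simp add: summable_in_Lp_def)
  have [measurable]: "f \<in> borel_measurable M" "g k \<in> borel_measurable M" for k
    using f gLp[of k] by (auto simp: Lp_iff)
  define a where "a k = Lp_pow M p (\<lambda>x. g k x - f x)" for k
  define A where "A = ennreal (2 powr p)"
  \<comment> \<open>Two triangle inequalities cost \<open>A\<close> each; the bracket adds 1 for
    \<open>g k - f\<close> and Schur's constant for its image.\<close>
  define B where "B = A * A * (1 + ennreal (C powr p))"
  have B: "B < \<infinity>" by (simp add: B_def A_def ennreal_mult_less_top)
  have le: "Lp_pow M p (\<lambda>x. T n f x - f x) \<le> B * a k + A * A * Lp_pow M p (\<lambda>x. T n (g k) x - g k x)"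
    for n k
  proof -
    define u where "u x = T n (\<lambda>x. f x - g k x) x" for x
    define v where "v x = T n (g k) x - g k x" for x
    define w where "w x = g k x - f x" for x
    have [measurable]: "u \<in> borel_measurable M" "v \<in> borel_measurable M" "w \<in> borel_measurable M"
      unfolding u_def[abs_def] v_def[abs_def] w_def[abs_def] by measurable
    have "Lp_pow M p u \<le> ennreal (C powr p) * Lp_pow M p (\<lambda>x. f x - g k x)"
      unfolding u_def[abs_def] by (intro schur_test Lp_diff p0 f gLp)
    also have "Lp_pow M p (\<lambda>x. f x - g k x) = a k"
      using Lp_pow_minus[of M p "\<lambda>x. g k x - f x"] by (simp add: a_def)
    finally have u: "Lp_pow M p u \<le> ennreal (C powr p) * a k" .
    have "Lp_pow M p (\<lambda>x. T n f x - f x) = Lp_pow M p (\<lambda>x. (u x + w x) + v x)"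
      by (intro Lp_pow_cong_AE AE_I2)
         (simp add: u_def v_def w_def T_diff Lp_integrable[OF p_ge_1] f gLp)
    also have "\<dots> \<le> A * (Lp_pow M p (\<lambda>x. u x + w x) + Lp_pow M p v)"
      unfolding A_def by (intro Lp_pow_add_le p0) simp_all
    also have "\<dots> \<le> A * (A * (Lp_pow M p u + Lp_pow M p w) + Lp_pow M p v)"
      unfolding A_def by (intro mult_left_mono add_right_mono Lp_pow_add_le p0) simp_all
    also have "\<dots> \<le> A * (A * (ennreal (C powr p) * a k + a k) + A * Lp_pow M p v)"
    proof (intro mult_left_mono add_mono u)
      show "Lp_pow M p w \<le> a k" by (simp add: w_def[abs_def] a_def)
      \<comment> \<open>The third part passes through only one triangle inequality; a further factor
        \<open>A\<close> gives all parts the same factor.\<close>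
      have "1 \<le> A" using p_ge_1 by (simp add: A_def ge_one_powr_ge_zero)
      then show "Lp_pow M p v \<le> A * Lp_pow M p v"
        using mult_right_mono[of 1 A "Lp_pow M p v"] by simp
    qed simp_all
    finally show ?thesis by (simp add: B_def v_def[abs_def] algebra_simps)
  qed
  have "(\<lambda>n. Lp_pow M p (\<lambda>x. T n f x - f x)) \<longlonglongrightarrow> 0"
  proof (rule order_tendstoI)
    fix e :: ennreal assume e: "0 < e"
    have "(\<lambda>k. B * a k) \<longlonglongrightarrow> B * 0"
      using lim B unfolding a_def by (intro ennreal_tendsto_cmult) auto
    then have "\<forall>\<^sub>F k in sequentially. B * a k < e"
      using e by (intro order_tendstoD) auto
    then obtain k where k: "B * a k < e" by (auto simp: eventually_sequentially)
    have "(\<lambda>n. B * a k + A * A * Lp_pow M p (\<lambda>x. T n (g k) x - g k x)) \<longlonglongrightarrow> B * a k + A * A * 0"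
      using g[of k] by (intro tendsto_add tendsto_const ennreal_tendsto_cmult)
        (auto simp: summable_in_Lp_def A_def ennreal_mult_less_top)
    then have "\<forall>\<^sub>F n in sequentially. B * a k + A * A * Lp_pow M p (\<lambda>x. T n (g k) x - g k x) < e"
      using k by (intro order_tendstoD) auto
    then show "\<forall>\<^sub>F n in sequentially. Lp_pow M p (\<lambda>x. T n f x - f x) < e"
      by eventually_elim (rule order_le_less_trans[OF le[of _ k]])
  qed auto
  then show ?thesis using f by (simp add: summable_in_Lp_def)
qed

text \<open>Dominated convergence for the \<open>p\<close>-th powers, with majorant
  \<open>norm (b x) powr p\<close>, provides the convergence needed for closedness.\<close>

lemma summable_in_Lp_dominated:
  assumes g: "\<And>k. summable_in_Lp (g k)" and f: "f \<in> Lp M p" and b: "b \<in> Lp M p"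
    and lim: "AE x in M. (\<lambda>k. g k x) \<longlonglongrightarrow> f x"
    and le: "\<And>k. AE x in M. norm (g k x - f x) \<le> norm (b x)"
  shows "summable_in_Lp f"
proof (rule summable_in_Lp_closed[OF g f])
  have [measurable]: "f \<in> borel_measurable M" "b \<in> borel_measurable M" "g k \<in> borel_measurable M" for k
    using f b g[of k] by (auto simp: Lp_iff summable_in_Lp_def)
  have "(\<lambda>k. Lp_pow M p (\<lambda>x. g k x - f x)) \<longlonglongrightarrow> (\<integral>\<^sup>+ x. 0 \<partial>M)"
    unfolding Lp_pow_def
  proof (rule nn_integral_dominated_convergence)
    show "AE x in M. ennreal (norm (g k x - f x) powr p) \<le> ennreal (norm (b x) powr p)" for k
      using le[of k] by eventually_elim (use p_ge_1 in \<open>auto intro!: ennreal_leI powr_mono2\<close>)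
    show "(\<integral>\<^sup>+ x. ennreal (norm (b x) powr p) \<partial>M) < \<infinity>"
      using b by (simp add: Lp_iff Lp_pow_def)
    show "AE x in M. (\<lambda>k. ennreal (norm (g k x - f x) powr p)) \<longlonglongrightarrow> 0"
      using lim
    proof eventually_elim
      case (elim x)
      then have "(\<lambda>k. norm (g k x - f x)) \<longlonglongrightarrow> 0" by (simp add: LIM_zero tendsto_norm_zero)
      then have "(\<lambda>k. norm (g k x - f x) powr p) \<longlonglongrightarrow> 0"
        using p_ge_1 by (intro tendsto_zero_powrI) auto
      then show ?case using tendsto_ennrealI by fastforce
    qed
  qed simp_all
  then show "(\<lambda>k. Lp_pow M p (\<lambda>x. g k x - f x)) \<longlonglongrightarrow> 0" by simp
qed

text \<open>Dynkin's argument: complements are handled by linearity, disjoint unions by dominated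
  convergence of the partial sums. \<open>\<Omega>\<close> may differ from \<open>space M\<close>,
  so a measure on an interval can be treated with the Borel sets of the line.\<close>

lemma summable_in_Lp_indicator_sigma_sets:
  assumes G: "Int_stable G" "G \<subseteq> Pow \<Omega>"
    and sets: "\<And>A. A \<in> sigma_sets \<Omega> G \<Longrightarrow> (indicator A :: 'a \<Rightarrow> complex) \<in> borel_measurable M"
    and basic: "\<And>A. A \<in> G \<Longrightarrow> summable_in_Lp (indicator A)"
    and whole: "summable_in_Lp (indicator \<Omega>)"
    and A: "A \<in> sigma_sets \<Omega> G"
  shows "summable_in_Lp (indicator A)"
  using G A
proof (induction A rule: sigma_sets_induct_disjoint)
  case (basic A)
  then show ?case by (rule assms(4))
next
  case empty
  then show ?case using summable_in_Lp_zero by (simp add: indicator_def[abs_def])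
next
  case (compl A)
  have "A \<subseteq> \<Omega>" using sigma_sets_into_sp[OF G(2) compl(1)] .
  then have "(indicator (\<Omega> - A) :: 'a \<Rightarrow> complex) = (\<lambda>x. indicator \<Omega> x + (-1) * indicator A x)"
    by (auto simp: fun_eq_iff indicator_def)
  then show ?case
    using summable_in_Lp_add[OF whole summable_in_Lp_cmult[OF compl(2), of "-1"]] by simp
next
  case (union A)
  have p0: "0 \<le> p" using p_ge_1 by simp
  have part: "(\<Sum>i<k. indicator (A i) x :: complex) = indicator (\<Union>i<k. A i) x" for k x
    using union(1) by (subst indicator_UN_disjoint)
      (auto simp: disjoint_family_on_def)
  have "(\<Union>i. A i) \<in> sigma_sets \<Omega> G" using union(2) by (auto intro: sigma_sets.Union)
  then have meas: "(indicator (\<Union>i. A i) :: 'a \<Rightarrow> complex) \<in> borel_measurable M" by (rule sets)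
  show ?case
  proof (rule summable_in_Lp_dominated)
    show "summable_in_Lp (\<lambda>x. \<Sum>i<k. indicator (A i) x)" for k
      by (intro summable_in_Lp_sum union)
    show "indicator (\<Union>i. A i) \<in> Lp M p"
      by (rule bounded_Lp[OF p0 meas, of 1]) (simp add: indicator_def)
    show "(\<lambda>x. 1) \<in> Lp M p" by (rule bounded_Lp[OF p0, of _ 1]) auto
    show "AE x in M. (\<lambda>k. \<Sum>i<k. indicator (A i) x :: complex) \<longlonglongrightarrow> indicator (\<Union>i. A i) x"
      unfolding part by (intro AE_I2 LIMSEQ_indicator_UN)
    show "AE x in M. norm ((\<Sum>i<k. indicator (A i) x) - indicator (\<Union>i. A i) x :: complex) \<le> norm (1::complex)"
      for k unfolding part by (auto simp: indicator_def)
  qed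
qed

text \<open>Approximation by simple functions bounded by \<open>2 * norm (f x)\<close>; the
  differences are therefore dominated by \<open>3 * f\<close>.\<close>

lemma summable_in_Lp_if_indicators:
  assumes ind: "\<And>A. A \<in> sets M \<Longrightarrow> summable_in_Lp (indicator A)" and f: "f \<in> Lp M p"
  shows "summable_in_Lp f"
proof -
  have [measurable]: "f \<in> borel_measurable M" using f by (simp add: Lp_iff)
  obtain F where F: "\<And>i. simple_function M (F i)"
      "\<And>x. x \<in> space M \<Longrightarrow> (\<lambda>i. F i x) \<longlonglongrightarrow> f x"
      "\<And>i x. x \<in> space M \<Longrightarrow> norm (F i x) \<le> 2 * norm (f x)"
    using borel_measurable_implies_sequence_metric[of f M 0] by (auto simp: Ball_def)
  have simple: "summable_in_Lp (F i)" for i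
  proof (rule summable_in_Lp_cong_AE)
    show "summable_in_Lp (\<lambda>x. \<Sum>v\<in>F i ` space M. v * indicator (F i -` {v} \<inter> space M) x)"
      using simple_functionD(2)[OF F(1)] by (intro summable_in_Lp_sum summable_in_Lp_cmult ind) auto
    show "F i \<in> borel_measurable M" using F(1) by (rule borel_measurable_simple_function)
    show "AE x in M. (\<Sum>v\<in>F i ` space M. v * indicator (F i -` {v} \<inter> space M) x) = F i x"
    proof (rule AE_I2)
      fix x assume x: "x \<in> space M"
      have "(\<Sum>v\<in>F i ` space M. v * indicator (F i -` {v} \<inter> space M) x) =
          (\<Sum>v\<in>F i ` space M. if v = F i x then v else 0)"
        using x by (intro sum.cong) (auto simp: indicator_def)
      also have "\<dots> = F i x" using x simple_functionD(1)[OF F(1)] by (simp add: sum.delta)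
      finally show "(\<Sum>v\<in>F i ` space M. v * indicator (F i -` {v} \<inter> space M) x) = F i x" .
    qed
  qed
  show ?thesis
  proof (rule summable_in_Lp_dominated[OF simple f Lp_cmult[OF f, of 3]])
    show "AE x in M. (\<lambda>i. F i x) \<longlonglongrightarrow> f x" using F(2) by simp
    show "AE x in M. norm (F i x - f x) \<le> norm (3 * f x)" for i
    proof (rule AE_I2)
      fix x assume "x \<in> space M"
      then show "norm (F i x - f x) \<le> norm (3 * f x)"
        using F(3)[of x i] norm_triangle_ineq4[of "F i x" "f x"] by (simp add: norm_mult)
    qed
  qed
qed

text \<open>The kernel bound gives \<open>norm (T n f x) \<le> B * C\<close>, so the constant
  \<open>(B * C + B) powr p\<close> is an integrable majorant.\<close>

lemma summable_in_Lp_pointwise: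
  assumes [measurable]: "f \<in> borel_measurable M"
    and B: "\<And>x. x \<in> space M \<Longrightarrow> norm (f x) \<le> B"
    and lim: "AE x in M. (\<lambda>n. T n f x) \<longlonglongrightarrow> f x"
  shows "summable_in_Lp f"
proof -
  have p0: "0 \<le> p" using p_ge_1 by simp
  have f: "f \<in> Lp M p" by (rule bounded_Lp[OF p0 assms(1) B])
  have bound: "norm (T n f x - f x) \<le> B * C + B" if x: "x \<in> space M" for n x
  proof -
    have B0: "0 \<le> B" using order_trans[OF norm_ge_zero B[OF x]] .
    have int_k: "integrable M (\<lambda>y. norm (K n x y))"
      using integrable_norm[OF integrable_mult_kernel[OF x, of "\<lambda>_. 1" n]] by simp
    have int_fk: "integrable M (\<lambda>y. norm (f y) * norm (K n x y))"
      using integrable_norm[OF integrable_mult_kernel[OF x Lp_integrable[OF p_ge_1 f], of n]]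
      by (simp add: norm_mult)
    have "norm (T n f x) \<le> (\<integral>y. norm (f y * K n x y) \<partial>M)"
      unfolding T_def by (rule integral_norm_bound)
    also have "\<dots> \<le> (\<integral>y. B * norm (K n x y) \<partial>M)"
      using B int_k int_fk
      by (intro integral_mono) (auto simp: norm_mult intro!: mult_right_mono)
    also have "\<dots> \<le> B * C"
      using kernel_L1[OF x] B0 by (simp add: mult_left_mono)
    finally show ?thesis using norm_triangle_ineq4[of "T n f x" "f x"] B[OF x] by simp
  qed
  have "(\<lambda>n. Lp_pow M p (\<lambda>x. T n f x - f x)) \<longlonglongrightarrow> (\<integral>\<^sup>+ x. 0 \<partial>M)"
    unfolding Lp_pow_def
  proof (rule nn_integral_dominated_convergence)
    show "AE x in M. ennreal (norm (T n f x - f x) powr p) \<le> ennreal ((B * C + B) powr p)" for n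
      using bound p0 by (intro AE_I2 ennreal_leI powr_mono2) auto
    show "(\<integral>\<^sup>+ x. ennreal ((B * C + B) powr p) \<partial>M) < \<infinity>"
      by (simp add: emeasure_space_1)
    show "AE x in M. (\<lambda>n. ennreal (norm (T n f x - f x) powr p)) \<longlonglongrightarrow> 0"
      using lim
    proof eventually_elim
      case (elim x)
      then have "(\<lambda>n. norm (T n f x - f x)) \<longlonglongrightarrow> 0" by (simp add: LIM_zero tendsto_norm_zero)
      then have "(\<lambda>n. norm (T n f x - f x) powr p) \<longlonglongrightarrow> 0"
        using p_ge_1 by (intro tendsto_zero_powrI) auto
      then show ?case using tendsto_ennrealI by fastforce
    qed
  qed simp_all
  then show ?thesis using f by (simp add: summable_in_Lp_def)
qed

end

section \<open>Cesaro means of Fourier expansions\<close>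

text \<open>\<open>I k\<close> is the index set of the \<open>k\<close>-th partial sum, which covers
  both one-sided and symmetric sums. For \<open>n = 0\<close>, division by zero makes the kernel
  0.\<close>

definition cesaro_kernel ::
  "('i \<Rightarrow> 'a \<Rightarrow> complex) \<Rightarrow> (nat \<Rightarrow> 'i set) \<Rightarrow> nat \<Rightarrow> 'a \<Rightarrow> 'a \<Rightarrow> complex" where
  "cesaro_kernel \<phi> I n x y = (1 / of_nat n) * (\<Sum>k<n. \<Sum>j\<in>I k. \<phi> j x * cnj (\<phi> j y))"

locale cesaro_means = prob_space M for M :: "'a measure" +
  fixes \<phi> :: "'i \<Rightarrow> 'a \<Rightarrow> complex" and I :: "nat \<Rightarrow> 'i set" and p C :: real
  assumes p_ge_1: "1 \<le> p" and C_pos: "0 < C"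
    and phi_measurable [measurable]: "\<phi> j \<in> borel_measurable M"
    and norm_phi: "norm (\<phi> j x) = 1"
    and cesaro_kernel_L1: "x \<in> space M \<Longrightarrow> (\<integral>y. norm (cesaro_kernel \<phi> I n x y) \<partial>M) \<le> C"
begin

text \<open>As the \<open>\<phi> j\<close> are unimodular, the kernel is bounded for each
  \<open>n\<close>; it is Hermitian, so its modulus is symmetric.\<close>

sublocale kernel_means M "cesaro_kernel \<phi> I" p C
proof
  show "(\<lambda>(x, y). cesaro_kernel \<phi> I n x y) \<in> borel_measurable (M \<Otimes>\<^sub>M M)" for n
    unfolding cesaro_kernel_def by measurable
  show "\<exists>B. \<forall>x\<in>space M. \<forall>y\<in>space M. norm (cesaro_kernel \<phi> I n x y) \<le> B" for n
  proof (intro exI ballI)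
    fix x y
    have "norm (\<Sum>k<n. \<Sum>j\<in>I k. \<phi> j x * cnj (\<phi> j y)) \<le> (\<Sum>k<n. \<Sum>j\<in>I k. 1)"
      by (intro sum_norm_le) (simp add: norm_mult norm_phi)
    then show "norm (cesaro_kernel \<phi> I n x y) \<le> norm (1 / complex_of_nat n) * (\<Sum>k<n. \<Sum>j\<in>I k. 1)"
      unfolding cesaro_kernel_def norm_mult by (intro mult_left_mono) auto
  qed
  show "norm (cesaro_kernel \<phi> I n x y) = norm (cesaro_kernel \<phi> I n y x)" for n x y
  proof -
    have "cesaro_kernel \<phi> I n x y = cnj (cesaro_kernel \<phi> I n y x)"
      by (simp add: cesaro_kernel_def mult.commute)
    then show ?thesis by simp
  qed
qed (fact p_ge_1 C_pos cesaro_kernel_L1)+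

lemma integrable_mult_cnj_phi:
  assumes "integrable M f"
  shows "integrable M (\<lambda>y. f y * cnj (\<phi> j y))"
  by (rule Bochner_Integration.integrable_bound[OF assms])
     (use assms in \<open>auto simp: norm_mult norm_phi\<close>)

lemma T_eq_cesaro:
  assumes f: "integrable M f"
  shows "T n f x =
    (1 / of_nat n) * (\<Sum>k<n. \<Sum>j\<in>I k. (\<integral>y. f y * cnj (\<phi> j y) \<partial>M) * \<phi> j x)"
proof -
  have int: "integrable M (\<lambda>y. (f y * cnj (\<phi> j y)) * \<phi> j x)" for j
    by (intro integrable_mult_left integrable_mult_cnj_phi f)
  have "T n f x = (\<integral>y. (1 / of_nat n) * (\<Sum>k<n. \<Sum>j\<in>I k. (f y * cnj (\<phi> j y)) * \<phi> j x) \<partial>M)"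
    unfolding T_def cesaro_kernel_def
    by (intro Bochner_Integration.integral_cong) (simp_all add: sum_distrib_left mult_ac)
  also have "\<dots> = (1 / of_nat n) * (\<Sum>k<n. \<Sum>j\<in>I k. (\<integral>y. (f y * cnj (\<phi> j y)) * \<phi> j x \<partial>M))"
    using int by (simp add: Bochner_Integration.integral_sum Bochner_Integration.integrable_sum)
  finally show ?thesis using integrable_mult_cnj_phi[OF f] by simp
qed

text \<open>The shape required of \<open>s\<close> is that of the unfolded means in both systems, so
  that each case reduces to indicators.\<close>

lemma cesaro_Lp_norm_tendsto_0:
  assumes ind: "\<And>A. A \<in> sets M \<Longrightarrow> summable_in_Lp (indicator A)" and f: "f \<in> Lp M p"
    and s: "\<And>n x. s n x =
      (1 / of_nat n) * (\<Sum>k<n. \<Sum>j\<in>I k. (\<integral>y. f y * cnj (\<phi> j y) \<partial>M) * \<phi> j x)"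
  shows "(\<lambda>n. Lp_norm M p (\<lambda>x. s n x - f x)) \<longlonglongrightarrow> 0"
proof -
  have "s n x = T n f x" for n x
    using s T_eq_cesaro[OF Lp_integrable[OF p_ge_1 f]] by simp
  then show ?thesis
    using summable_in_Lp_if_indicators[OF ind f] p_ge_1
    by (intro Lp_norm_tendsto_0) (auto simp: summable_in_Lp_def)
qed

end

section \<open>Vilenkin systems\<close>

lemma sum_lessThan_add:
  fixes f :: "nat \<Rightarrow> 'a::comm_monoid_add"
  shows "(\<Sum>k<a + b. f k) = (\<Sum>k<a. f k) + (\<Sum>k<b. f (a + k))"
  by (induction b) (simp_all add: add.assoc)

lemma vilenkin_r_cis: "vilenkin_r m k x = cis (2 * pi * real (x k) / real (m k))"
  by (simp add: vilenkin_r_def cis_conv_exp mult_ac)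

lemma norm_vilenkin_r [simp]: "norm (vilenkin_r m k x) = 1"
  by (simp add: vilenkin_r_cis)

lemma norm_vilenkin_psi: "norm (vilenkin_psi m n x) = 1"
  by (simp add: vilenkin_psi_def norm_power flip: prod_norm)

lemma mult_cnj_vilenkin_psi [simp]: "vilenkin_psi m n x * cnj (vilenkin_psi m n x) = 1"
  by (simp add: norm_vilenkin_psi complex_norm_square[symmetric])

section \<open>The product measure and cylinder sets\<close>

locale vilenkin =
  fixes m :: "nat \<Rightarrow> nat"
  assumes m_ge_2: "\<And>k. 2 \<le> m k"
begin

abbreviation "\<mu> \<equiv> vilenkin_measure m"
abbreviation "M \<equiv> vilenkin_M m"
abbreviation "\<psi> \<equiv> vilenkin_psi m"

lemma m_pos [simp]: "0 < m k"
  using m_ge_2[of k] by simp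

lemma M_pos [simp]: "0 < M k"
  by (simp add: vilenkin_M_def prod_pos)

lemma m_neq_0 [simp]: "m k \<noteq> 0" and M_neq_0 [simp]: "M k \<noteq> 0"
  using m_pos[of k] M_pos[of k] by (simp_all del: m_pos M_pos)

sublocale product_prob_space "\<lambda>k. uniform_count_measure {..<m k}" UNIV
proof (intro product_prob_spaceI prob_space_uniform_count_measure)
  show "{..<m k} \<noteq> {}" for k using m_pos[of k] by blast
qed simp

sublocale mu: prob_space \<mu>
  unfolding vilenkin_measure_def by (rule prob_space_axioms)

lemma space_mu: "space \<mu> = {x. \<forall>k. x k < m k}"
  by (auto simp: vilenkin_measure_def space_PiM space_uniform_count_measure PiE_def Pi_def)

text \<open>Empty if some \<open>z i\<close> with \<open>i < A\<close> is not a residue modulo \<open>m i\<close>.\<close>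

definition cyl :: "nat \<Rightarrow> (nat \<Rightarrow> nat) \<Rightarrow> (nat \<Rightarrow> nat) set" where
  "cyl A z = {y \<in> space \<mu>. \<forall>i<A. y i = z i}"

lemma sets_cyl [measurable]: "cyl A z \<in> sets \<mu>"
  and measure_cyl: "(\<And>i. i < A \<Longrightarrow> z i < m i) \<Longrightarrow> measure \<mu> (cyl A z) = 1 / real (M A)"
proof -
  let ?N = "\<lambda>k. uniform_count_measure {..<m k}"
  \<comment> \<open>Intersecting with the residues keeps each factor measurable even where
    \<open>z i\<close> is not a residue.\<close>
  let ?X = "\<lambda>i. {..<m i} \<inter> {z i}"
  have eq: "cyl A z = prod_emb UNIV ?N {..<A} (Pi\<^sub>E {..<A} ?X)"
  proof (rule set_eqI)
    fix y
    have "y \<in> prod_emb UNIV ?N {..<A} (Pi\<^sub>E {..<A} ?X) \<longleftrightarrow>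
        (\<forall>k. y k < m k) \<and> (\<forall>i<A. y i < m i \<and> y i = z i)"
      by (auto simp: prod_emb_def space_uniform_count_measure PiE_iff)
    then show "y \<in> cyl A z \<longleftrightarrow> y \<in> prod_emb UNIV ?N {..<A} (Pi\<^sub>E {..<A} ?X)"
      by (auto simp: cyl_def space_mu)
  qed
  have X: "?X i \<in> sets (?N i)" for i by (simp add: sets_uniform_count_measure)
  show "cyl A z \<in> sets \<mu>"
    unfolding eq vilenkin_measure_def using X by (intro sets_PiM_I) auto
  assume z: "\<And>i. i < A \<Longrightarrow> z i < m i"
  have "measure \<mu> (cyl A z) = (\<Prod>i<A. measure (?N i) (?X i))"
    unfolding eq vilenkin_measure_def using X by (intro measure_PiM_emb) auto
  also have "\<dots> = (\<Prod>i<A. 1 / real (m i))"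
  proof (intro prod.cong refl)
    fix i assume "i \<in> {..<A}"
    then have "?X i = {z i}" using z by auto
    then show "measure (?N i) (?X i) = 1 / real (m i)"
      using z \<open>i \<in> {..<A}\<close> by (subst measure_uniform_count_measure) auto
  qed
  finally show "measure \<mu> (cyl A z) = 1 / real (M A)"
    by (simp add: vilenkin_M_def prod_dividef)
qed

lemma cyl_eq_if_mem: "y \<in> cyl A z \<Longrightarrow> cyl A y = cyl A z"
  by (auto simp: cyl_def)

section \<open>Functions of finitely many coordinates\<close>

text \<open>Quantified over all sequences rather than the points of the group, so that it applies to
  \<open>restrict y {..<A}\<close>, which is \<open>undefined\<close> from \<open>A\<close>
  on.\<close>

definition depends :: "nat \<Rightarrow> ((nat \<Rightarrow> nat) \<Rightarrow> 'b) \<Rightarrow> bool" where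
  "depends A u \<longleftrightarrow> (\<forall>x y. (\<forall>i<A. x i = y i) \<longrightarrow> u x = u y)"

lemma dependsD: "depends A u \<Longrightarrow> (\<And>i. i < A \<Longrightarrow> x i = y i) \<Longrightarrow> u x = u y"
  by (auto simp: depends_def)

text \<open>The indices \<open>z\<close> are extensional, so exactly one of the cylinders contains
  \<open>y\<close>, that of \<open>restrict y {..<A}\<close>.\<close>

lemma sum_cyl:
  fixes u :: "(nat \<Rightarrow> nat) \<Rightarrow> real"
  assumes u: "depends A u" and y: "y \<in> space \<mu>"
  shows "u y = (\<Sum>z\<in>Pi\<^sub>E {..<A} (\<lambda>i. {..<m i}). u z * indicator (cyl A z) y)"
proof -
  have "(\<Sum>z\<in>Pi\<^sub>E {..<A} (\<lambda>i. {..<m i}). u z * indicator (cyl A z) y) =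
      (\<Sum>z\<in>Pi\<^sub>E {..<A} (\<lambda>i. {..<m i}). if z = restrict y {..<A} then u z else 0)"
  proof (intro sum.cong refl)
    fix z assume z: "z \<in> Pi\<^sub>E {..<A} (\<lambda>i. {..<m i})"
    have "y \<in> cyl A z \<longleftrightarrow> z = restrict y {..<A}"
      using y z by (auto simp: cyl_def PiE_def extensional_def restrict_def fun_eq_iff)
    then show "u z * indicator (cyl A z) y = (if z = restrict y {..<A} then u z else 0)"
      by (simp add: indicator_def)
  qed
  also have "\<dots> = u (restrict y {..<A})"
    using y by (subst sum.delta) (auto simp: finite_PiE space_mu)
  also have "\<dots> = u y" by (rule dependsD[OF u]) simp
  finally show ?thesis by simp
qed

text \<open>Coordinate \<open>A\<close> is independent of \<open>u\<close> and equals
  \<open>c\<close> with probability \<open>1 / m A\<close>, which the factor \<open>m A\<close>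
  cancels. Concretely, fixing it turns \<open>cyl A z\<close> into
  \<open>cyl (Suc A) (z(A := c))\<close>, whose measure is smaller by the factor
  \<open>m A\<close>.\<close>

lemma integral_coordinate_indep:
  fixes u :: "(nat \<Rightarrow> nat) \<Rightarrow> real"
  assumes u: "depends A u" and c: "c < m A"
  shows "(\<integral>y. (if y A = c then real (m A) * u y else 0) \<partial>\<mu>) = (\<integral>y. u y \<partial>\<mu>)"
proof -
  let ?Z = "Pi\<^sub>E {..<A} (\<lambda>i. {..<m i})"
  have fin: "finite ?Z" by (intro finite_PiE) auto
  have "(\<integral>y. (if y A = c then real (m A) * u y else 0) \<partial>\<mu>) =
      (\<integral>y. (\<Sum>z\<in>?Z. real (m A) * u z * indicator (cyl (Suc A) (z(A := c))) y) \<partial>\<mu>)"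
  proof (intro Bochner_Integration.integral_cong refl)
    fix y assume y: "y \<in> space \<mu>"
    have "indicator (cyl (Suc A) (z(A := c))) y = (if y A = c then indicator (cyl A z) y else (0::real))" for z
      by (auto simp: cyl_def indicator_def less_Suc_eq)
    then show "(if y A = c then real (m A) * u y else 0) =
        (\<Sum>z\<in>?Z. real (m A) * u z * indicator (cyl (Suc A) (z(A := c))) y)"
      by (simp add: sum_cyl[OF u y] sum_distrib_left mult.assoc)
  qed
  also have "\<dots> = (\<Sum>z\<in>?Z. real (m A) * u z * measure \<mu> (cyl (Suc A) (z(A := c))))"
    by (subst Bochner_Integration.integral_sum) (auto simp: mu.emeasure_eq_measure)
  also have "\<dots> = (\<Sum>z\<in>?Z. u z * measure \<mu> (cyl A z))"
  proof (intro sum.cong refl)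
    fix z assume z: "z \<in> ?Z"
    then have "measure \<mu> (cyl (Suc A) (z(A := c))) = 1 / real (M (Suc A))"
      using c by (intro measure_cyl) (auto simp: PiE_def)
    moreover have "measure \<mu> (cyl A z) = 1 / real (M A)"
      using z by (intro measure_cyl) (auto simp: PiE_def)
    ultimately show "real (m A) * u z * measure \<mu> (cyl (Suc A) (z(A := c))) = u z * measure \<mu> (cyl A z)"
      by simp
  qed
  also have "\<dots> = (\<integral>y. (\<Sum>z\<in>?Z. u z * indicator (cyl A z) y) \<partial>\<mu>)"
    by (subst Bochner_Integration.integral_sum) (auto simp: mu.emeasure_eq_measure)
  also have "\<dots> = (\<integral>y. u y \<partial>\<mu>)"
    by (intro Bochner_Integration.integral_cong refl) (simp add: sum_cyl[OF u])
  finally show ?thesis .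
qed

section \<open>Characters and digits\<close>

lemma vilenkin_r_measurable [measurable]: "vilenkin_r m k \<in> borel_measurable \<mu>"
proof -
  have "(\<lambda>x. x k) \<in> measurable \<mu> (count_space UNIV)"
    unfolding vilenkin_measure_def
    using measurable_component_singleton[of k UNIV "\<lambda>k. uniform_count_measure {..<m k}"]
    by (rule measurable_compose) (auto simp: measurable_def space_uniform_count_measure sets_uniform_count_measure)
  then show ?thesis unfolding vilenkin_r_def by measurable
qed

lemma psi_measurable [measurable]: "\<psi> n \<in> borel_measurable \<mu>"
  unfolding vilenkin_psi_def[abs_def] by measurable

text \<open>Pads the product to a range independent of \<open>n\<close>: the digits from
  \<open>N\<close> on vanish since \<open>n < M N \<le> M k\<close> for
  \<open>N \<le> k\<close>.\<close>

lemma psi_eq_prod: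
  assumes "n < M N"
  shows "\<psi> n x = (\<Prod>k<N. vilenkin_r m k x ^ vilenkin_digit m n k)"
  unfolding vilenkin_psi_def
proof (rule prod.mono_neutral_left)
  have "vilenkin_digit m n k = 0" if "N \<le> k" for k
  proof -
    have "M N \<le> M k"
      unfolding vilenkin_M_def using that
      by (intro dvd_imp_le prod_dvd_prod_subset) (auto simp: prod_pos)
    then show ?thesis using assms by (simp add: vilenkin_digit_def)
  qed
  then show "{k. vilenkin_digit m n k \<noteq> 0} \<subseteq> {..<N}" by (auto intro: not_le_imp_less)
qed auto

text \<open>The digits of \<open>q * M A + s\<close> are those of \<open>s\<close> below
  \<open>A\<close>, then \<open>q\<close> at \<open>A\<close>, then zeros; uniqueness of the
  expansion identifies them.\<close>

lemma psi_add:
  assumes q: "q < m A" and s: "s < M A"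
  shows "\<psi> (q * M A + s) x = vilenkin_r m A x ^ q * \<psi> s x"
proof -
  define d where "d j = (if j < A then vilenkin_digit m s j else if j = A then q else 0)" for j
  have sub: "{j. d j \<noteq> 0} \<subseteq> {..<Suc A}" by (auto simp: d_def split: if_splits)
  have "(\<Sum>j | d j \<noteq> 0. d j * M j) = (\<Sum>j<Suc A. d j * M j)"
    using sub by (intro sum.mono_neutral_left) auto
  also have "\<dots> = (\<Sum>j<A. vilenkin_digit m s j * M j) + q * M A"
    by (simp add: d_def)
  also have "\<dots> = q * M A + s" using s by (simp add: vilenkin_expansion_mod)
  finally have sum: "q * M A + s = (\<Sum>j | d j \<noteq> 0. d j * M j)" ..
  have d: "d = vilenkin_digit m (q * M A + s)"
  proof (rule vilenkin_digit_unique[OF _ _ sum])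
    show "d j < m j" for j using q vilenkin_digit_less[of m, OF m_ge_2] by (simp add: d_def)
    show "finite {j. d j \<noteq> 0}" using sub by (rule finite_subset) simp
  qed
  have "q * M A + s < Suc q * M A" using s by simp
  also have "\<dots> \<le> m A * M A" using q by (intro mult_le_mono1) simp
  finally have "q * M A + s < M (Suc A)" by simp
  then have "\<psi> (q * M A + s) x = (\<Prod>k<Suc A. vilenkin_r m k x ^ d k)"
    unfolding d by (rule psi_eq_prod)
  also have "\<dots> = vilenkin_r m A x ^ q * \<psi> s x"
    by (simp add: d_def psi_eq_prod[OF s] mult.commute)
  finally show ?thesis .
qed

lemma depends_psi: "n < M A \<Longrightarrow> depends A (\<psi> n)"
  by (auto simp: depends_def psi_eq_prod vilenkin_r_def intro!: prod.cong)

section \<open>Recursions for the Dirichlet and Fejer kernels\<close>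

text \<open>\<open>D n\<close> is the Dirichlet kernel and \<open>F n\<close> is \<open>n\<close> times the Fejer kernel, both taken at
  the difference of \<open>x\<close> and \<open>y\<close> in the group.\<close>

definition D :: "nat \<Rightarrow> (nat \<Rightarrow> nat) \<Rightarrow> (nat \<Rightarrow> nat) \<Rightarrow> complex" where
  "D n x y = (\<Sum>j<n. \<psi> j x * cnj (\<psi> j y))"

definition F :: "nat \<Rightarrow> (nat \<Rightarrow> nat) \<Rightarrow> (nat \<Rightarrow> nat) \<Rightarrow> complex" where
  "F n x y = (\<Sum>k<n. D k x y)"

text \<open>The value of \<open>vilenkin_r m A\<close> at the group difference of \<open>x\<close>
  and \<open>y\<close>, since conjugation inverts numbers of modulus 1.\<close>

definition \<rho> :: "nat \<Rightarrow> (nat \<Rightarrow> nat) \<Rightarrow> (nat \<Rightarrow> nat) \<Rightarrow> complex" where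
  "\<rho> A x y = vilenkin_r m A x * cnj (vilenkin_r m A y)"

lemma norm_rho [simp]: "norm (\<rho> A x y) = 1"
  by (simp add: \<rho>_def norm_mult)

lemma rho_measurable [measurable]: "\<rho> A x \<in> borel_measurable \<mu>"
  unfolding \<rho>_def[abs_def] by measurable

text \<open>A geometric sum over a root of unity of order dividing \<open>m A\<close>. The root is 1
  only if the coordinates agree, because distinct residues give distinct roots.\<close>

lemma sum_rho:
  assumes "x \<in> space \<mu>" "y \<in> space \<mu>"
  shows "(\<Sum>l<m A. \<rho> A x y ^ l) = (if y A = x A then of_nat (m A) else 0)"
proof (cases "y A = x A")
  case True
  then have "\<rho> A x y = 1"
    by (simp add: \<rho>_def vilenkin_r_cis cis_cnj cis_mult)
  then show ?thesis using True by simp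
next
  case False
  have bij: "bij_betw (\<lambda>k. cis (2 * pi * real k / real (m A))) {..<m A} {z. z ^ m A = 1}"
    using Complex.bij_betw_roots_unity[OF m_pos] .
  have xy: "x A \<in> {..<m A}" "y A \<in> {..<m A}" using assms by (auto simp: space_mu)
  have pow: "vilenkin_r m A x ^ m A = 1" "vilenkin_r m A y ^ m A = 1"
    using bij_betwE[OF bij] xy by (auto simp: vilenkin_r_cis)
  have "vilenkin_r m A x \<noteq> vilenkin_r m A y"
    using bij_betw_imp_inj_on[OF bij] xy False by (auto simp: vilenkin_r_cis dest: inj_onD)
  moreover have "vilenkin_r m A y * cnj (vilenkin_r m A y) = 1"
    by (simp add: complex_norm_square[symmetric])
  ultimately have ne: "\<rho> A x y \<noteq> 1"
    unfolding \<rho>_def by (metis mult.assoc mult.commute mult.right_neutral)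
  have "\<rho> A x y ^ m A = vilenkin_r m A x ^ m A * cnj (vilenkin_r m A y ^ m A)"
    by (simp add: \<rho>_def power_mult_distrib)
  then have "\<rho> A x y ^ m A = 1" by (simp add: pow)
  then show ?thesis using False ne by (simp add: geometric_sum)
qed

text \<open>Every index \<open>q * M A + j\<close> with \<open>j < s\<close> has digit
  \<open>q\<close> at \<open>A\<close>. Only \<open>j < s\<close> occurs, so \<open>s = M A\<close>
  is allowed and full blocks can be added.\<close>

lemma D_add:
  assumes "q < m A" "s \<le> M A"
  shows "D (q * M A + s) x y = D (q * M A) x y + \<rho> A x y ^ q * D s x y"
  unfolding D_def sum_lessThan_add
  using assms by (simp add: psi_add \<rho>_def power_mult_distrib sum_distrib_left mult_ac)

lemma D_mult:
  "q \<le> m A \<Longrightarrow> D (q * M A) x y = (\<Sum>l<q. \<rho> A x y ^ l) * D (M A) x y"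
proof (induction q)
  case (Suc q)
  then show ?case using D_add[of q A "M A" x y] by (simp add: algebra_simps)
qed (simp add: D_def)

text \<open>Paley's lemma. Passing from \<open>A\<close> to \<open>Suc A\<close> multiplies the
  kernel by the geometric sum in \<open>\<rho> A x y\<close>, which adds the condition
  \<open>y A = x A\<close> and the factor \<open>m A\<close>.\<close>

lemma D_M:
  assumes "x \<in> space \<mu>" "y \<in> space \<mu>"
  shows "D (M A) x y = of_nat (M A) * indicator (cyl A x) y"
proof (induction A)
  case 0
  have "\<psi> 0 z = 1" for z by (simp add: vilenkin_psi_def vilenkin_digit_def)
  then show ?case using assms by (simp add: D_def cyl_def)
next
  case (Suc A)
  have "D (M (Suc A)) x y = (\<Sum>l<m A. \<rho> A x y ^ l) * D (M A) x y"
    using D_mult[of "m A" A x y] by simp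
  then show ?case
    using assms by (auto simp: sum_rho Suc indicator_def cyl_def less_Suc_eq)
qed

text \<open>Each of the \<open>s\<close> Dirichlet kernels from index \<open>q * M A\<close> on
  consists of \<open>D (q * M A)\<close> and a rotated \<open>D k\<close> with
  \<open>k < s\<close>.\<close>

lemma F_add:
  assumes "q < m A" "s \<le> M A"
  shows "F (q * M A + s) x y =
    F (q * M A) x y + of_nat s * D (q * M A) x y + \<rho> A x y ^ q * F s x y"
  unfolding F_def sum_lessThan_add
  using assms by (simp add: D_add sum.distrib sum_distrib_left)

lemma F_mult:
  "q \<le> m A \<Longrightarrow> F (q * M A) x y =
    (\<Sum>l<q. of_nat (M A) * D (l * M A) x y) + (\<Sum>l<q. \<rho> A x y ^ l) * F (M A) x y"
proof (induction q)
  case (Suc q)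
  then show ?case using F_add[of q A "M A" x y] by (simp add: algebra_simps)
qed (simp add: F_def)

lemma D_measurable [measurable]: "D n x \<in> borel_measurable \<mu>"
  unfolding D_def[abs_def] by measurable

lemma F_measurable [measurable]: "F n x \<in> borel_measurable \<mu>"
  unfolding F_def[abs_def] by measurable

lemma depends_F: "n \<le> M A \<Longrightarrow> depends A (F n x)"
  unfolding F_def D_def depends_def
proof (intro allI impI)
  fix y z :: "nat \<Rightarrow> nat"
  assume n: "n \<le> M A" and yz: "\<forall>i<A. y i = z i"
  have "\<psi> j y = \<psi> j z" if "j < n" for j
    using that n yz by (intro dependsD[OF depends_psi[of j A]]) auto
  then show "(\<Sum>k<n. \<Sum>j<k. \<psi> j x * cnj (\<psi> j y)) = (\<Sum>k<n. \<Sum>j<k. \<psi> j x * cnj (\<psi> j z))"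
    by (intro sum.cong refl) auto
qed

section \<open>Uniform integral bounds for the Fejer kernels\<close>

text \<open>A crude bound which, like \<open>norm_F_le\<close>, serves to secure
  integrability.\<close>

lemma norm_D_le: "norm (D n x y) \<le> real n"
  unfolding D_def
  by (rule order_trans[OF norm_sum]) (simp add: norm_mult norm_vilenkin_psi)

lemma norm_F_le: "norm (F n x y) \<le> real n * real n"
proof -
  have "norm (F n x y) \<le> (\<Sum>k<n. real n)"
    unfolding F_def by (rule sum_norm_le) (auto intro: order_trans[OF norm_D_le])
  then show ?thesis by simp
qed

lemma integrable_norm_D [simp, intro]: "integrable \<mu> (\<lambda>y. norm (D n x y))"
  by (rule mu.integrable_const_bound[of _ "real n"]) (auto simp: norm_D_le)

lemma integrable_norm_F [simp, intro]: "integrable \<mu> (\<lambda>y. norm (F n x y))"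
  by (rule mu.integrable_const_bound[of _ "real n * real n"]) (auto simp: norm_F_le)

lemma norm_geometric_rho_le: "norm (\<Sum>l<q. \<rho> A x y ^ l) \<le> real q"
  by (rule order_trans[OF norm_sum]) (simp add: norm_power)

lemma integral_norm_D_M:
  assumes x: "x \<in> space \<mu>"
  shows "(\<integral>y. norm (D (M A) x y) \<partial>\<mu>) = 1"
proof -
  have "(\<integral>y. norm (D (M A) x y) \<partial>\<mu>) = (\<integral>y. real (M A) * indicator (cyl A x) y \<partial>\<mu>)"
    by (intro Bochner_Integration.integral_cong refl) (simp add: D_M[OF x] norm_mult indicator_def)
  also have "\<dots> = real (M A) * measure \<mu> (cyl A x)" by simp
  also have "measure \<mu> (cyl A x) = 1 / real (M A)"
    using x by (intro measure_cyl) (auto simp: space_mu)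
  finally show ?thesis using M_pos[of A] by simp
qed

lemma integral_norm_D_mult_le:
  assumes x: "x \<in> space \<mu>" and q: "q \<le> m A"
  shows "(\<integral>y. norm (D (q * M A) x y) \<partial>\<mu>) \<le> real q"
proof -
  have "(\<integral>y. norm (D (q * M A) x y) \<partial>\<mu>) \<le> (\<integral>y. real q * norm (D (M A) x y) \<partial>\<mu>)"
  proof (rule integral_mono)
    show "norm (D (q * M A) x y) \<le> real q * norm (D (M A) x y)" for y
      by (auto simp: D_mult[OF q] norm_mult intro!: mult_right_mono norm_geometric_rho_le)
  qed auto
  then show ?thesis using integral_norm_D_M[OF x] by simp
qed

lemma norm_F_mult_le:
  assumes q: "q \<le> m A"
  shows "norm (F (q * M A) x y) \<le> real (M A) * (\<Sum>l<q. norm (D (l * M A) x y)) +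
    norm (\<Sum>l<q. \<rho> A x y ^ l) * norm (F (M A) x y)"
proof -
  have "norm (\<Sum>l<q. of_nat (M A) * D (l * M A) x y) \<le> real (M A) * (\<Sum>l<q. norm (D (l * M A) x y))"
    unfolding sum_distrib_left by (rule order_trans[OF norm_sum]) (simp add: norm_mult)
  then show ?thesis unfolding F_mult[OF q]
    by (intro order_trans[OF norm_triangle_ineq] add_mono) (simp_all add: norm_mult)
qed

context
  fixes b :: nat
  assumes m_le: "\<And>k. m k \<le> b"
begin

lemma sum_integral_norm_D_le:
  assumes x: "x \<in> space \<mu>" and q: "q \<le> m A"
  shows "(\<Sum>l<q. \<integral>y. norm (D (l * M A) x y) \<partial>\<mu>) \<le> real q * real b"
proof -
  have "(\<Sum>l<q. \<integral>y. norm (D (l * M A) x y) \<partial>\<mu>) \<le> (\<Sum>l<q. real b)"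
  proof (rule sum_mono)
    fix l assume "l \<in> {..<q}"
    then have "l \<le> m A" "l \<le> b" using q m_le[of A] by auto
    then show "(\<integral>y. norm (D (l * M A) x y) \<partial>\<mu>) \<le> real b"
      using integral_norm_D_mult_le[OF x, of l A] by linarith
  qed
  then show ?thesis by simp
qed

text \<open>By independence the integral grows by at most \<open>b ^ 2 * M A\<close> from
  \<open>A\<close> to \<open>Suc A\<close>; as \<open>M\<close> at least doubles in each step, these
  increments sum to the claimed bound.\<close>

lemma integral_norm_F_M_le:
  assumes x: "x \<in> space \<mu>"
  shows "(\<integral>y. norm (F (M A) x y) \<partial>\<mu>) \<le> real b ^ 2 * real (M A)"
proof (induction A)
  case 0
  then show ?case by (simp add: F_def D_def)
next
  case (Suc A)
  define S where "S y = (if y A = x A then real (m A) * norm (F (M A) x y) else 0)" for y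
  have eqS: "norm (\<Sum>l<m A. \<rho> A x y ^ l) * norm (F (M A) x y) = S y" if "y \<in> space \<mu>" for y
    using that x by (simp add: sum_rho S_def)
  have dep: "depends A (\<lambda>y. norm (F (M A) x y))"
    unfolding depends_def
    by (intro allI impI arg_cong[where f = norm] dependsD[OF depends_F[OF order_refl]]) blast
  have [measurable]: "S \<in> borel_measurable \<mu>"
    by (rule measurable_cong[THEN iffD1, of \<mu> "\<lambda>y. norm (\<Sum>l<m A. \<rho> A x y ^ l) * norm (F (M A) x y)"])
       (auto simp: eqS)
  have intS: "integrable \<mu> S"
    by (rule mu.integrable_const_bound[of _ "real (m A) * (real (M A) * real (M A))"])
       (auto simp: S_def norm_F_le)
  have "(\<integral>y. norm (F (M (Suc A)) x y) \<partial>\<mu>) \<le>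
      (\<integral>y. real (M A) * (\<Sum>l<m A. norm (D (l * M A) x y)) + S y \<partial>\<mu>)"
  proof (rule integral_mono)
    show "norm (F (M (Suc A)) x y) \<le> real (M A) * (\<Sum>l<m A. norm (D (l * M A) x y)) + S y"
      if "y \<in> space \<mu>" for y
      using norm_F_mult_le[of "m A" A x y] eqS[OF that] by simp
  qed (auto intro!: intS)
  also have "\<dots> = real (M A) * (\<Sum>l<m A. \<integral>y. norm (D (l * M A) x y) \<partial>\<mu>) + (\<integral>y. S y \<partial>\<mu>)"
    using intS by simp
  \<comment> \<open>The factor \<open>m A\<close> is cancelled by the probability of
    \<open>y A = x A\<close>; estimating the geometric sum by \<open>m A\<close> would lose it in
    every step.\<close>
  also have "(\<integral>y. S y \<partial>\<mu>) = (\<integral>y. norm (F (M A) x y) \<partial>\<mu>)"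
    unfolding S_def using x by (intro integral_coordinate_indep dep) (auto simp: space_mu)
  also have "real (M A) * (\<Sum>l<m A. \<integral>y. norm (D (l * M A) x y) \<partial>\<mu>) + \<dots> \<le>
      real (M A) * (real b * real b) + real b ^ 2 * real (M A)"
  proof (intro add_mono mult_left_mono Suc)
    have "(\<Sum>l<m A. \<integral>y. norm (D (l * M A) x y) \<partial>\<mu>) \<le> real (m A) * real b"
      by (rule sum_integral_norm_D_le[OF x]) simp
    also have "\<dots> \<le> real b * real b" using m_le[of A] by (intro mult_right_mono) auto
    finally show "(\<Sum>l<m A. \<integral>y. norm (D (l * M A) x y) \<partial>\<mu>) \<le> real b * real b" .
  qed simp
  \<comment> \<open>The new term and the induction hypothesis contribute equally, and
    \<open>2 \<le> m A\<close> absorbs the doubling.\<close>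
  also have "\<dots> = real b ^ 2 * (2 * real (M A))" by (simp add: power2_eq_square)
  also have "\<dots> \<le> real b ^ 2 * real (M (Suc A))"
    using m_ge_2[of A] by (intro mult_left_mono) auto
  finally show ?case .
qed

text \<open>Here the trivial estimate \<open>q\<close> of the geometric sum suffices, because the
  claimed bound is itself proportional to \<open>q * M A\<close>.\<close>

lemma integral_norm_F_mult_le:
  assumes x: "x \<in> space \<mu>" and q: "q \<le> m A"
  shows "(\<integral>y. norm (F (q * M A) x y) \<partial>\<mu>) \<le> real q * real (M A) * (real b + real b ^ 2)"
proof -
  have "(\<integral>y. norm (F (q * M A) x y) \<partial>\<mu>) \<le>
      (\<integral>y. real (M A) * (\<Sum>l<q. norm (D (l * M A) x y)) + real q * norm (F (M A) x y) \<partial>\<mu>)"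
  proof (rule integral_mono)
    show "norm (F (q * M A) x y) \<le>
        real (M A) * (\<Sum>l<q. norm (D (l * M A) x y)) + real q * norm (F (M A) x y)" for y
      by (rule order_trans[OF norm_F_mult_le[OF q]])
         (intro add_left_mono mult_right_mono norm_geometric_rho_le norm_ge_zero)
  qed auto
  also have "\<dots> = real (M A) * (\<Sum>l<q. \<integral>y. norm (D (l * M A) x y) \<partial>\<mu>) +
      real q * (\<integral>y. norm (F (M A) x y) \<partial>\<mu>)"
    by simp
  also have "\<dots> \<le> real (M A) * (real q * real b) + real q * (real b ^ 2 * real (M A))"
    by (intro add_mono mult_left_mono sum_integral_norm_D_le integral_norm_F_M_le x q) auto
  finally show ?thesis by (simp add: algebra_simps)
qed

text \<open>Induction on the number of digits, splitting off the top one. The bound is linear in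
  \<open>n\<close>, so the parts \<open>q * M A\<close> and \<open>s\<close> add up without
  increasing the constant.\<close>

lemma integral_norm_F_le:
  assumes x: "x \<in> space \<mu>"
  shows "n < M A \<Longrightarrow> (\<integral>y. norm (F n x y) \<partial>\<mu>) \<le> (real b ^ 2 + real b + 1) * real n"
proof (induction A arbitrary: n)
  case 0
  then show ?case by (simp add: F_def)
next
  case (Suc A)
  define q where "q = n div M A"
  define s where "s = n mod M A"
  have n: "n = q * M A + s" by (simp only: q_def s_def div_mult_mod_eq)
  have s: "s < M A" by (simp add: s_def)
  have q: "q < m A" using Suc.prems unfolding q_def by (simp add: less_mult_imp_div_less)
  have "(\<integral>y. norm (F n x y) \<partial>\<mu>) \<le>
      (\<integral>y. norm (F (q * M A) x y) + real s * norm (D (q * M A) x y) + norm (F s x y) \<partial>\<mu>)"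
  proof (rule integral_mono)
    show "norm (F n x y) \<le> norm (F (q * M A) x y) + real s * norm (D (q * M A) x y) + norm (F s x y)"
      for y
      unfolding n F_add[OF q less_imp_le[OF s]]
      by (intro order_trans[OF norm_triangle_ineq] add_mono) (simp_all add: norm_mult norm_power)
  qed auto
  also have "\<dots> = (\<integral>y. norm (F (q * M A) x y) \<partial>\<mu>) + real s * (\<integral>y. norm (D (q * M A) x y) \<partial>\<mu>) +
      (\<integral>y. norm (F s x y) \<partial>\<mu>)"
    by simp
  \<comment> \<open>Replacing \<open>s\<close> by \<open>M A\<close> in the middle term yields
    \<open>q * M A\<close>, which is the 1 in the constant.\<close>
  also have "\<dots> \<le> real q * real (M A) * (real b + real b ^ 2) + real (M A) * real q +
      (real b ^ 2 + real b + 1) * real s"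
    using q s
    by (intro add_mono mult_mono integral_norm_F_mult_le integral_norm_D_mult_le Suc.IH x) auto
  also have "\<dots> = (real b ^ 2 + real b + 1) * real n"
    unfolding n by (simp add: algebra_simps)
  finally show ?case .
qed

lemma integral_norm_kernel_le:
  assumes x: "x \<in> space \<mu>"
  shows "(\<integral>y. norm (cesaro_kernel \<psi> (\<lambda>k. {..<k}) n x y) \<partial>\<mu>) \<le> real b ^ 2 + real b + 1"
proof (cases "n = 0")
  case False
  have "(\<integral>y. norm (cesaro_kernel \<psi> (\<lambda>k. {..<k}) n x y) \<partial>\<mu>) = (\<integral>y. norm (F n x y) \<partial>\<mu>) / real n"
    by (simp add: cesaro_kernel_def F_def D_def norm_divide)
  also have "\<dots> \<le> (real b ^ 2 + real b + 1) * real n / real n"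
    \<comment> \<open>Since \<open>n < M n\<close>, the choice \<open>A = n\<close> is
      admissible.\<close>
    using integral_norm_F_le[OF x vilenkin_M_gt[OF m_ge_2]] by (intro divide_right_mono) auto
  finally show ?thesis using False by simp
qed (simp add: cesaro_kernel_def)

lemma cesaro_means_vilenkin:
  "1 \<le> p \<Longrightarrow> cesaro_means \<mu> \<psi> (\<lambda>k. {..<k}) p (real b ^ 2 + real b + 1)"
  using integral_norm_kernel_le
  by unfold_locales (auto simp: norm_vilenkin_psi add_nonneg_pos)

end

section \<open>Orthonormality and generation by cylinders\<close>

lemma integrable_psi_mult_cnj: "integrable \<mu> (\<lambda>y. \<psi> i y * cnj (\<psi> j y))"
  by (rule mu.integrable_const_bound[of _ 1]) (auto simp: norm_mult norm_vilenkin_psi)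

text \<open>Projecting \<open>\<psi>\<^sub>i\<close> to the span of the \<open>\<psi>\<^sub>j\<close> with \<open>j < M\<^sub>A\<close> reproduces it; comparing
  norms, the coefficients with \<open>j \<noteq> i\<close> vanish.\<close>

lemma psi_orthonormal: "(\<integral>y. \<psi> i y * cnj (\<psi> j y) \<partial>\<mu>) = (if j = i then 1 else 0)"
proof -
  define c where "c i j = (\<integral>y. \<psi> i y * cnj (\<psi> j y) \<partial>\<mu>)" for i j
  have diag: "c i i = 1" for i by (simp add: c_def mu.prob_space)
  have "c i j = 0" if ij: "j \<noteq> i"
  proof -
    define A where "A = max i j"
    have less: "i < M A" "j < M A"
      using vilenkin_M_gt[of m A, OF m_ge_2] by (auto simp: A_def)
    have repr: "\<psi> i x = (\<Sum>k<M A. c i k * \<psi> k x)" if x: "x \<in> space \<mu>" for x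
    proof -
      have "(\<Sum>k<M A. c i k * \<psi> k x) = (\<integral>y. (\<Sum>k<M A. (\<psi> i y * cnj (\<psi> k y)) * \<psi> k x) \<partial>\<mu>)"
        using integrable_psi_mult_cnj
        by (simp add: c_def Bochner_Integration.integral_sum)
      also have "\<dots> = (\<integral>y. \<psi> i y * D (M A) x y \<partial>\<mu>)"
        by (simp add: D_def sum_distrib_left mult_ac)
      also have "\<dots> = (\<integral>y. (\<psi> i x * of_nat (M A)) * of_real (indicator (cyl A x) y) \<partial>\<mu>)"
      proof (intro Bochner_Integration.integral_cong refl)
        fix y assume y: "y \<in> space \<mu>"
        \<comment> \<open>The kernel averages over \<open>cyl A x\<close>, on which
          \<open>\<psi> i\<close> is constant as \<open>i < M A\<close>.\<close>
        have "\<psi> i y = \<psi> i x" if "y \<in> cyl A x"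
          using that by (intro dependsD[OF depends_psi[OF less(1)]]) (auto simp: cyl_def)
        then show "\<psi> i y * D (M A) x y = (\<psi> i x * of_nat (M A)) * of_real (indicator (cyl A x) y)"
          by (simp add: D_M[OF x y] indicator_def)
      qed
      also have "\<dots> = \<psi> i x * of_nat (M A) * of_real (measure \<mu> (cyl A x))"
        by (simp only: integral_mult_right_zero integral_complex_of_real) simp
      also have "measure \<mu> (cyl A x) = 1 / real (M A)"
        using x by (intro measure_cyl) (auto simp: space_mu)
      finally show ?thesis using M_pos[of A] by simp
    qed
    have cnj_c: "cnj (c i k) = c k i" for k
      unfolding c_def Bochner_Integration.integral_cnj[symmetric] by (simp add: mult.commute)
    have "1 = (\<integral>x. \<psi> i x * cnj (\<psi> i x) \<partial>\<mu>)" by (simp add: mu.prob_space)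
    also have "\<dots> = (\<integral>x. (\<Sum>k<M A. c i k * (\<psi> k x * cnj (\<psi> i x))) \<partial>\<mu>)"
      by (intro Bochner_Integration.integral_cong refl)
         (subst repr, simp_all add: sum_distrib_left sum_distrib_right mult_ac del: mult_cnj_vilenkin_psi)
    also have "\<dots> = (\<Sum>k<M A. c i k * cnj (c i k))"
      unfolding cnj_c using integrable_psi_mult_cnj
      by (simp add: c_def Bochner_Integration.integral_sum)
    also have "\<dots> = of_real (\<Sum>k<M A. (norm (c i k))\<^sup>2)"
      by (simp only: complex_norm_square[symmetric] of_real_sum)
    finally have "(\<Sum>k<M A. (norm (c i k))\<^sup>2) = 1"
      by (metis of_real_eq_1_iff)
    moreover have "(\<Sum>k\<in>{i, j}. (norm (c i k))\<^sup>2) \<le> (\<Sum>k<M A. (norm (c i k))\<^sup>2)"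
      using less by (intro sum_mono2) auto
    ultimately show "c i j = 0" using ij diag by simp
  qed
  then show ?thesis using diag unfolding c_def by auto
qed

text \<open>A condition on the single coordinate \<open>i\<close> is a finite union of cylinders of
  length \<open>Suc i\<close>, and such conditions generate the product
  \<open>\<sigma>\<close>-algebra.\<close>

lemma sets_mu_eq: "sets \<mu> = sigma_sets (space \<mu>) {cyl A z | A z. True}"
proof
  let ?G = "{cyl A z | A z. True}"
  have sub: "?G \<subseteq> Pow (space \<mu>)" by (auto simp: cyl_def)
  interpret S: sigma_algebra "space \<mu>" "sigma_sets (space \<mu>) ?G"
    using sub by (rule sigma_algebra_sigma_sets)
  show "sigma_sets (space \<mu>) ?G \<subseteq> sets \<mu>"
    using sets_cyl by (intro sets.sigma_sets_subset) auto
  have sp: "space \<mu> = (\<Pi>\<^sub>E i\<in>UNIV. space (uniform_count_measure {..<m i}))"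
    by (simp add: vilenkin_measure_def space_PiM)
  have "{f \<in> space \<mu>. f i \<in> B} \<in> sigma_sets (space \<mu>) ?G" for i B
  proof -
    let ?W = "{w \<in> Pi\<^sub>E {..<Suc i} (\<lambda>k. {..<m k}). w i \<in> B}"
    have "{f \<in> space \<mu>. f i \<in> B} = (\<Union>w\<in>?W. cyl (Suc i) w)"
    proof (intro equalityI subsetI)
      fix f assume f: "f \<in> {f \<in> space \<mu>. f i \<in> B}"
      then have "restrict f {..<Suc i} \<in> ?W" "f \<in> cyl (Suc i) (restrict f {..<Suc i})"
        by (auto simp: space_mu cyl_def)
      then show "f \<in> (\<Union>w\<in>?W. cyl (Suc i) w)" by blast
    qed (auto simp: cyl_def)
    also have "\<dots> \<in> sigma_sets (space \<mu>) ?G"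
    proof (rule S.finite_UN)
      have "finite (Pi\<^sub>E {..<Suc i} (\<lambda>k. {..<m k}))" by (intro finite_PiE) auto
      then show "finite ?W" by simp
    qed (auto intro: sigma_sets.Basic)
    finally show ?thesis .
  qed
  then show "sets \<mu> \<subseteq> sigma_sets (space \<mu>) ?G"
    unfolding vilenkin_measure_def sets_PiM_single
    unfolding vilenkin_measure_def[symmetric] sp[symmetric]
    by (intro S.sigma_sets_subset) auto
qed

section \<open>Convergence for Vilenkin systems\<close>

theorem vilenkin_sigma_Lp_tendsto:
  assumes p: "1 \<le> p" and m_le: "\<And>k. m k \<le> b" and f: "f \<in> Lp \<mu> p"
  shows "(\<lambda>n. Lp_norm \<mu> p (\<lambda>x. vilenkin_sigma m n f x - f x)) \<longlonglongrightarrow> 0"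
proof -
  interpret cesaro_means \<mu> \<psi> "\<lambda>k. {..<k}" p "real b ^ 2 + real b + 1"
    using m_le p by (rule cesaro_means_vilenkin)
  have psi: "summable_in_Lp (\<psi> i)" for i
  proof (rule summable_in_Lp_pointwise[of _ 1])
    have int: "integrable \<mu> (\<psi> i)"
      by (rule mu.integrable_const_bound[of _ 1]) (auto simp: norm_vilenkin_psi)
    \<comment> \<open>By orthonormality \<open>\<psi> i\<close> is reproduced by the
      \<open>k\<close>-th partial sum exactly for \<open>k > i\<close>, hence by
      \<open>n - Suc i\<close> of the \<open>n\<close> sums; truncated subtraction covers
      \<open>n \<le> i\<close>.\<close>
    have count: "(\<Sum>k<n. if i < k then z else 0) = of_nat (n - Suc i) * z" for n and z :: complex
      by (induction n) (auto simp: Suc_diff_le algebra_simps less_Suc_eq_le not_less)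
    have "T n (\<psi> i) x = of_nat (n - Suc i) / of_nat n * \<psi> i x" for n x
      unfolding T_eq_cesaro[OF int] psi_orthonormal
      by (simp add: if_distrib[of "\<lambda>c. c * _"] sum.delta count cong: if_cong)
    moreover have "(\<lambda>n. of_nat (n - Suc i) / of_nat n :: complex) \<longlonglongrightarrow> 1"
    proof -
      have "(\<lambda>n. 1 - of_nat (Suc i) / of_nat n :: complex) \<longlonglongrightarrow> 1 - 0"
        by (intro tendsto_diff tendsto_const lim_const_over_n)
      moreover have "\<forall>\<^sub>F n in sequentially.
          (1 - of_nat (Suc i) / of_nat n :: complex) = of_nat (n - Suc i) / of_nat n"
        using eventually_ge_at_top[of "Suc i"]
        by eventually_elim (simp add: of_nat_diff field_simps)
      ultimately show ?thesis using Lim_transform_eventually by fastforce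
    qed
    ultimately show "AE x in \<mu>. (\<lambda>n. T n (\<psi> i) x) \<longlonglongrightarrow> \<psi> i x"
      using tendsto_mult_right[of _ "1::complex"] by fastforce
  qed (auto simp: norm_vilenkin_psi)
  have ind_cyl: "summable_in_Lp (indicator (cyl A z))" for A z
  proof (cases "cyl A z = {}")
    case True
    then show ?thesis using summable_in_Lp_zero by (simp add: indicator_def[abs_def])
  next
    case False
    then obtain y where y: "y \<in> cyl A z" by blast
    then have sp: "y \<in> space \<mu>" by (simp add: cyl_def)
    show ?thesis unfolding cyl_eq_if_mem[OF y, symmetric]
    proof (rule summable_in_Lp_cong_AE)
      \<comment> \<open>Paley's lemma, read in the variable \<open>x\<close>: the indicator is
        \<open>D (M A) x y / of_nat (M A)\<close>.\<close>
      show "summable_in_Lp (\<lambda>x. \<Sum>j<M A. (cnj (\<psi> j y) / of_nat (M A)) * \<psi> j x)"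
        by (intro summable_in_Lp_sum summable_in_Lp_cmult psi)
      show "indicator (cyl A y) \<in> borel_measurable \<mu>" by simp
      show "AE x in \<mu>. (\<Sum>j<M A. (cnj (\<psi> j y) / of_nat (M A)) * \<psi> j x) = indicator (cyl A y) x"
      proof (rule AE_I2)
        fix x assume x: "x \<in> space \<mu>"
        have "(\<Sum>j<M A. (cnj (\<psi> j y) / of_nat (M A)) * \<psi> j x) = D (M A) x y / of_nat (M A)"
          by (simp add: D_def sum_divide_distrib mult.commute)
        also have "\<dots> = indicator (cyl A x) y"
          using M_pos[of A] by (simp add: D_M[OF x sp])
        also have "\<dots> = indicator (cyl A y) x"
          using x sp by (auto simp: cyl_def indicator_def)
        finally show "(\<Sum>j<M A. (cnj (\<psi> j y) / of_nat (M A)) * \<psi> j x) = indicator (cyl A y) x" .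
      qed
    qed
  qed
  have "summable_in_Lp (indicator A)" if "A \<in> sets \<mu>" for A
  proof (rule summable_in_Lp_indicator_sigma_sets)
    show "Int_stable {cyl A z | A z. True}"
    proof (rule Int_stableI)
      fix U V assume "U \<in> {cyl A z | A z. True}" "V \<in> {cyl A z | A z. True}"
      then obtain A z B w where UV: "U = cyl A z" "V = cyl B w" by blast
      have "\<exists>C v. U \<inter> V = cyl C v"
      proof (cases "U \<inter> V = {}")
        case True
        \<comment> \<open>The empty intersection is itself a cylinder, since \<open>m 0\<close> is
          not a residue modulo \<open>m 0\<close>.\<close>
        have "cyl 1 (\<lambda>_. m 0) = {}" by (auto simp: cyl_def space_mu intro!: exI[of _ 0])
        with True show ?thesis by metis
      next
        case False
        then obtain y where y: "y \<in> U" "y \<in> V" by blast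
        \<comment> \<open>A common point can define both cylinders, so the longer one is the
          intersection.\<close>
        have "U \<inter> V = cyl A y \<inter> cyl B y"
          using y unfolding UV by (simp add: cyl_eq_if_mem)
        also have "\<dots> = cyl (max A B) y" by (auto simp: cyl_def less_max_iff_disj)
        finally show ?thesis by blast
      qed
      then show "U \<inter> V \<in> {cyl A z | A z. True}" by blast
    qed
    show "{cyl A z | A z. True} \<subseteq> Pow (space \<mu>)" by (auto simp: cyl_def)
    show "A \<in> sigma_sets (space \<mu>) {cyl A z | A z. True}" using that sets_mu_eq by simp
    show "(indicator B :: _ \<Rightarrow> complex) \<in> borel_measurable \<mu>"
      if "B \<in> sigma_sets (space \<mu>) {cyl A z | A z. True}" for B
      using that unfolding sets_mu_eq[symmetric] by simp
    have "cyl 0 undefined = space \<mu>" by (simp add: cyl_def)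
    then show "summable_in_Lp (indicator (space \<mu>))" using ind_cyl by metis
  qed (auto intro: ind_cyl)
  then show ?thesis
    by (rule cesaro_Lp_norm_tendsto_0[OF _ f])
       (simp_all add: vilenkin_sigma_def vilenkin_S_def vilenkin_coeff_def)
qed

end

section \<open>The trigonometric system\<close>

text \<open>Negative indices are written \<open>k - n\<close> and positive ones
  \<open>n - k\<close>, with \<open>k < n\<close>. This gives the cross terms needed in
  \<open>fejer_identity\<close>.\<close>

lemma sum_symmetric_exp:
  fixes t :: real
  shows "(\<Sum>j\<in>{- int n..int n}. exp (\<i> * of_int j * of_real t)) =
    (\<Sum>k<n. exp (\<i> * of_nat k * of_real t) * cnj (exp (\<i> * of_nat n * of_real t))) + 1 +
    (\<Sum>k<n. exp (\<i> * of_nat n * of_real t) * cnj (exp (\<i> * of_nat k * of_real t)))"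
proof -
  define e where "e j = exp (\<i> * of_int j * complex_of_real t)" for j
  define A where "A = (\<lambda>k. int k - int n) ` {..<n}"
  define B where "B = (\<lambda>k. int n - int k) ` {..<n}"
  have eq: "{- int n..int n} = A \<union> insert 0 B"
  proof (intro equalityI subsetI)
    fix j assume "j \<in> {- int n..int n}"
    then show "j \<in> A \<union> insert 0 B"
      unfolding A_def B_def image_def
      by (cases j "0::int" rule: linorder_cases)
         (auto intro: bexI[of _ "nat (j + int n)"] bexI[of _ "nat (int n - j)"])
  qed (auto simp: A_def B_def)
  have disj: "finite A" "finite B" "A \<inter> insert 0 B = {}" "0 \<notin> B"
    by (auto simp: A_def B_def)
  have "(\<Sum>j\<in>{- int n..int n}. e j) = sum e A + (e 0 + sum e B)"
    unfolding eq using disj by (simp add: sum.union_disjoint)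
  also have "sum e A = (\<Sum>k<n. e (int k - int n))"
    unfolding A_def by (subst sum.reindex) (auto simp: inj_on_def)
  also have "sum e B = (\<Sum>k<n. e (int n - int k))"
    unfolding B_def by (subst sum.reindex) (auto simp: inj_on_def)
  finally show ?thesis
    by (simp add: e_def exp_cnj algebra_simps flip: exp_add)
qed

text \<open>With \<open>s\<close> the sum of the first \<open>n\<close> exponentials and
  \<open>z\<close> the next one, the new Dirichlet kernel is exactly the difference of the squared
  moduli of \<open>s + z\<close> and \<open>s\<close>. Nonnegativity of the kernel is then
  visible.\<close>

lemma fejer_identity:
  fixes t :: real
  shows "(\<Sum>k<n. \<Sum>j\<in>{- int k..int k}. exp (\<i> * of_int j * of_real t)) =
    of_real ((norm (\<Sum>k<n. exp (\<i> * of_nat k * complex_of_real t)))\<^sup>2)"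
proof (induction n)
  case (Suc n)
  define s where "s = (\<Sum>k<n. exp (\<i> * of_nat k * complex_of_real t))"
  define z where "z = exp (\<i> * of_nat n * complex_of_real t)"
  have z: "z * cnj z = 1"
    by (simp add: z_def exp_cnj flip: exp_add)
  have "(\<Sum>k<Suc n. \<Sum>j\<in>{- int k..int k}. exp (\<i> * of_int j * complex_of_real t)) =
      s * cnj s + (s * cnj z + 1 + z * cnj s)"
    unfolding sum.lessThan_Suc[of _ n] Suc.IH sum_symmetric_exp[of t n]
    by (simp add: s_def z_def sum_distrib_left sum_distrib_right complex_norm_square del: of_real_power)
  also have "\<dots> = (s + z) * cnj (s + z)" by (simp add: algebra_simps z)
  also have "\<dots> = of_real ((norm (s + z))\<^sup>2)" by (simp only: complex_norm_square)
  finally show ?case by (simp add: s_def z_def)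
qed simp

abbreviation trig_char :: "int \<Rightarrow> real \<Rightarrow> complex" where
  "trig_char j x \<equiv> exp (\<i> * of_int j * of_real x)"

abbreviation trig_kernel :: "nat \<Rightarrow> real \<Rightarrow> real \<Rightarrow> complex" where
  "trig_kernel \<equiv> cesaro_kernel trig_char (\<lambda>k. {- int k..int k})"

lemma trig_kernel_eq:
  "trig_kernel n x y =
    of_real ((norm (\<Sum>k<n. exp (\<i> * of_nat k * complex_of_real (x - y))))\<^sup>2 / real n)"
proof -
  have "trig_char j x * cnj (trig_char j y) = exp (\<i> * of_int j * complex_of_real (x - y))" for j
    by (simp add: exp_cnj algebra_simps flip: exp_add)
  then show ?thesis
    unfolding cesaro_kernel_def fejer_identity[symmetric] of_real_divide by simp
qed

lemma norm_trig_kernel: "of_real (norm (trig_kernel n x y)) = trig_kernel n x y"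
  unfolding trig_kernel_eq norm_of_real by (subst abs_of_nonneg) simp_all

text \<open>In the closed form of the geometric sum the numerator is at most 2 and the denominator
  at least \<open>c\<close>.\<close>

lemma norm_trig_kernel_le:
  assumes c: "0 < c" "c \<le> norm (1 - exp (\<i> * complex_of_real (x - y)))"
  shows "norm (trig_kernel n x y) \<le> 4 / c\<^sup>2 / real n"
proof -
  define z where "z = exp (\<i> * complex_of_real (x - y))"
  have z: "z \<noteq> 1" using c by (auto simp: z_def)
  have "exp (\<i> * of_nat k * complex_of_real (x - y)) = z ^ k" for k
    by (simp add: z_def mult.assoc mult.left_commute flip: exp_of_nat_mult)
  then have "norm (\<Sum>k<n. exp (\<i> * of_nat k * complex_of_real (x - y))) = norm (\<Sum>k<n. z ^ k)"
    by simp
  also have "\<dots> = norm (z ^ n - 1) / norm (1 - z)"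
    using z by (simp add: geometric_sum norm_divide norm_minus_commute)
  also have "\<dots> \<le> 2 / c"
  proof (rule frac_le)
    have "norm z = 1" by (simp add: z_def)
    then show "norm (z ^ n - 1) \<le> 2" using norm_triangle_ineq4[of "z ^ n" 1] by (simp add: norm_power)
  qed (use c in \<open>auto simp: z_def\<close>)
  finally have "(norm (\<Sum>k<n. exp (\<i> * of_nat k * complex_of_real (x - y))))\<^sup>2 \<le> (2 / c)\<^sup>2"
    by (rule power_mono) simp
  from divide_right_mono[OF this, of "real n"] show ?thesis
    unfolding trig_kernel_eq norm_of_real by (subst abs_of_nonneg) (simp_all add: power_divide)
qed

section \<open>The normalized measure on the interval\<close>

lemma sets_trig_measure: "sets trig_measure = sets (lebesgue_on {-pi..pi})"
  by (simp add: trig_measure_def)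

lemma space_trig_measure: "space trig_measure = {-pi..pi}"
  by (simp add: trig_measure_def)

lemma borel_measurable_trig:
  assumes "f \<in> measurable borel N"
  shows "f \<in> measurable trig_measure N"
proof -
  have "f \<in> measurable lebesgue N" using assms by (intro measurable_completion) simp
  then have "f \<in> measurable (lebesgue_on {-pi..pi}) N" by (rule measurable_restrict_space1)
  then show ?thesis by (simp add: trig_measure_def)
qed

text \<open>Null sets survive completion, restriction to the interval and a constant
  density.\<close>

lemma AE_trig_measure:
  assumes "AE x in lborel. P x"
  shows "AE x in trig_measure. P x"
  unfolding trig_measure_def using AE_completion[OF assms]
  by (subst AE_density) (auto simp: AE_restrict_space_iff)

lemma prob_space_trig_measure: "prob_space trig_measure"
proof
  have "emeasure trig_measure (space trig_measure) =
      (\<integral>\<^sup>+ x. ennreal (1 / (2 * pi)) \<partial>lebesgue_on {-pi..pi})"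
    unfolding trig_measure_def
    by (subst emeasure_density, simp, simp, rule nn_integral_cong) simp
  also have "\<dots> = ennreal (1 / (2 * pi)) * ennreal (2 * pi)"
    by (simp add: emeasure_restrict_space)
  also have "\<dots> = 1"
    by (simp flip: ennreal_mult')
  finally show "emeasure trig_measure (space trig_measure) = 1" .
qed

interpretation trig: prob_space trig_measure by (rule prob_space_trig_measure)

text \<open>For \<open>j \<noteq> 0\<close> the antiderivative takes equal values at both ends,
  since the exponents there differ by \<open>j\<close> periods.\<close>

lemma integral_trig_char:
  "(\<integral>y. trig_char j y \<partial>trig_measure) = (if j = 0 then 1 else 0)"
proof (cases "j = 0")
  case True
  then show ?thesis by (simp add: trig.prob_space)
next
  case False
  have cont: "continuous_on {-pi..pi} (trig_char j)" by (intro continuous_intros)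
  have "((\<lambda>y. exp (\<i> * of_int j * of_real y) / (\<i> * of_int j)) has_vector_derivative trig_char j y)
      (at y within {-pi..pi})" for y
    using False by (auto intro!: derivative_eq_intros has_vector_derivative_real_field)
  then have "(trig_char j has_integral
      exp (\<i> * of_int j * of_real pi) / (\<i> * of_int j) -
      exp (\<i> * of_int j * of_real (-pi)) / (\<i> * of_int j)) {-pi..pi}"
    by (intro fundamental_theorem_of_calculus) auto
  moreover have "exp (\<i> * of_int j * of_real pi) = exp (\<i> * of_int j * of_real (-pi))"
    unfolding exp_eq by (rule exI[of _ j]) (simp add: algebra_simps)
  ultimately have "integral {-pi..pi} (trig_char j) = 0" by (simp add: integral_unique)
  moreover have "integral\<^sup>L (lebesgue_on {-pi..pi}) (trig_char j) = integral {-pi..pi} (trig_char j)"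
    by (intro lebesgue_integral_eq_integral continuous_imp_integrable_real cont) auto
  moreover have "(\<integral>y. trig_char j y \<partial>trig_measure) =
      (\<integral>y. (1 / (2 * pi)) *\<^sub>R trig_char j y \<partial>lebesgue_on {-pi..pi})"
    unfolding trig_measure_def
    by (rule integral_density) (auto intro!: continuous_imp_measurable_on_sets_lebesgue cont)
  ultimately show ?thesis using False by simp
qed

text \<open>Only \<open>j = 0\<close> survives the integration, and it occurs once in each of the
  \<open>n\<close> partial sums.\<close>

lemma integral_trig_kernel:
  assumes "0 < n"
  shows "(\<integral>y. trig_kernel n x y \<partial>trig_measure) = 1"
proof -
  have int: "integrable trig_measure (trig_char j)" for j
    by (rule trig.integrable_const_bound[of _ 1])
       (auto intro!: borel_measurable_trig borel_measurable_continuous_onI continuous_intros)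
  have cnj: "cnj (trig_char j y) = trig_char (-j) y" for j y
    by (simp add: exp_cnj)
  have "(\<integral>y. trig_kernel n x y \<partial>trig_measure) =
      (1 / of_nat n) * (\<Sum>k<n. \<Sum>j\<in>{- int k..int k}. trig_char j x * (if j = 0 then 1 else 0))"
    unfolding cesaro_kernel_def cnj
    using int integral_trig_char
    by (simp add: Bochner_Integration.integral_sum Bochner_Integration.integrable_sum del: of_int_minus)
  also have "\<dots> = (1 / of_nat n) * (\<Sum>k<n. 1)"
    by (intro arg_cong2[where f = "(*)"] sum.cong refl)
       (simp add: if_distrib sum.delta cong: if_cong)
  finally show ?thesis using assms by simp
qed

text \<open>The kernel is nonnegative, so for \<open>n > 0\<close> the value is its integral 1; for
  \<open>n = 0\<close> it is 0.\<close>

lemma integral_norm_trig_kernel_le: "(\<integral>y. norm (trig_kernel n x y) \<partial>trig_measure) \<le> 1"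
proof (cases "n = 0")
  case False
  have "complex_of_real (\<integral>y. norm (trig_kernel n x y) \<partial>trig_measure) = 1"
    unfolding integral_complex_of_real[symmetric] norm_trig_kernel
    using False by (intro integral_trig_kernel) simp
  then show ?thesis by (simp only: of_real_eq_1_iff order_refl)
qed (simp add: cesaro_kernel_def)

lemma cesaro_means_trig:
  assumes "1 \<le> p"
  shows "cesaro_means trig_measure trig_char (\<lambda>k. {- int k..int k}) p 1"
  using assms integral_norm_trig_kernel_le
  by unfold_locales
     (auto intro!: borel_measurable_trig borel_measurable_continuous_onI continuous_intros)

text \<open>A positive continuous function on a compact set is bounded away from 0.\<close>

lemma norm_one_minus_exp_bounded_below:
  assumes x: "-pi < x" "x < pi" and d: "0 < d"
  obtains c where "0 < c"
    "\<And>y. y \<in> {-pi..pi} \<Longrightarrow> d \<le> \<bar>y - x\<bar> \<Longrightarrow> c \<le> norm (1 - exp (\<i> * complex_of_real (x - y)))"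
proof -
  define S where "S = {-pi..pi} \<inter> {y. d \<le> \<bar>y - x\<bar>}"
  define F where "F y = norm (1 - exp (\<i> * complex_of_real (x - y)))" for y
  have pos: "0 < F y" if "y \<in> S" for y
  proof (rule ccontr)
    assume "\<not> 0 < F y"
    then have "exp (\<i> * complex_of_real (x - y)) = exp 0" by (simp add: F_def)
    then obtain k :: int where "\<i> * complex_of_real (x - y) = of_real (2 * k * pi) * \<i>"
      unfolding exp_eq by auto
    then have "complex_of_real (x - y) = of_real (2 * k * pi)" by (simp add: mult.commute)
    then have k: "x - y = 2 * k * pi" by (simp only: of_real_eq_iff)
    \<comment> \<open>Strict because \<open>x\<close> is interior; for an endpoint, the opposite one
      would be a zero.\<close>
    have "\<bar>x - y\<bar> < 2 * pi" using x that by (auto simp: S_def)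
    then have "\<bar>real_of_int k\<bar> * (2 * pi) < 1 * (2 * pi)" unfolding k by (simp add: abs_mult)
    then have "\<bar>real_of_int k\<bar> < 1" by (rule mult_right_less_imp_less) simp
    then have "k = 0" by linarith
    with k d that show False by (simp add: S_def)
  qed
  have "compact S" unfolding S_def
    by (intro compact_Int_closed closed_Collect_le continuous_intros) auto
  moreover have "continuous_on S F" unfolding F_def[abs_def] by (intro continuous_intros)
  ultimately obtain c where "0 < c" "\<And>y. y \<in> S \<Longrightarrow> c \<le> F y"
    by (cases "S = {}") (use pos in \<open>auto intro: that[of 1] dest!: continuous_attains_inf\<close>)
  then show thesis by (intro that[of c]) (auto simp: S_def F_def)
qed

section \<open>Convergence in the trigonometric case\<close>

context
  fixes p :: real
  assumes p: "1 \<le> p"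
begin

interpretation cesaro_means trig_measure trig_char "\<lambda>k. {- int k..int k}" p 1
  using p by (rule cesaro_means_trig)

text \<open>As the kernel has integral 1, the error is the integral of \<open>f y - f x\<close>
  against it. The integrand vanishes within \<open>d\<close> of \<open>x\<close>, and elsewhere the
  kernel is of order \<open>1 / n\<close>.\<close>

lemma trig_T_tendsto_if_locally_constant:
  assumes f: "f \<in> borel_measurable trig_measure" and B: "\<And>y. norm (f y) \<le> B"
    and x: "-pi < x" "x < pi" and d: "0 < d" "\<And>y. \<bar>y - x\<bar> < d \<Longrightarrow> f y = f x"
  shows "(\<lambda>n. T n f x) \<longlonglongrightarrow> f x"
proof -
  obtain c where c: "0 < c"
    "\<And>y. y \<in> {-pi..pi} \<Longrightarrow> d \<le> \<bar>y - x\<bar> \<Longrightarrow> c \<le> norm (1 - exp (\<i> * complex_of_real (x - y)))"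
    using norm_one_minus_exp_bounded_below[OF x d(1)] by blast
  have sp: "x \<in> space trig_measure" using x by (simp add: space_trig_measure)
  have intf: "integrable trig_measure f"
    using f B by (intro trig.integrable_const_bound[of _ B]) auto
  have B0: "0 \<le> B" using order_trans[OF norm_ge_zero B] .
  have le: "norm (T n f x - f x) \<le> (2 * B * (4 / c\<^sup>2)) / real n" if n: "0 < n" for n
  proof -
    have int: "integrable trig_measure (\<lambda>y. (f y - f x) * trig_kernel n x y)"
      by (intro integrable_mult_kernel sp Bochner_Integration.integrable_diff intf) simp
    have "T n (\<lambda>y. f y - f x) x = T n f x - T n (\<lambda>y. f x) x"
      by (intro T_diff intf sp) simp
    also have "T n (\<lambda>y. f x) x = f x"
      using integral_trig_kernel[OF n] by (simp add: T_def)
    finally have "norm (T n f x - f x) = norm (\<integral>y. (f y - f x) * trig_kernel n x y \<partial>trig_measure)"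
      by (simp add: T_def)
    also have "\<dots> \<le> (\<integral>y. norm ((f y - f x) * trig_kernel n x y) \<partial>trig_measure)"
      by (rule integral_norm_bound)
    also have "\<dots> \<le> (\<integral>y. (2 * B * (4 / c\<^sup>2)) / real n \<partial>trig_measure)"
    proof (rule integral_mono)
      fix y assume y: "y \<in> space trig_measure"
      show "norm ((f y - f x) * trig_kernel n x y) \<le> (2 * B * (4 / c\<^sup>2)) / real n"
      proof (cases "\<bar>y - x\<bar> < d")
        case True
        show ?thesis using d(2)[OF True] B0 by simp
      next
        case False
        have "norm (f y - f x) \<le> 2 * B"
          using norm_triangle_ineq4[of "f y" "f x"] B[of x] B[of y] by simp
        moreover have "norm (trig_kernel n x y) \<le> 4 / c\<^sup>2 / real n"
          using c y False by (intro norm_trig_kernel_le) (auto simp: space_trig_measure)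
        ultimately have "norm (f y - f x) * norm (trig_kernel n x y) \<le> 2 * B * (4 / c\<^sup>2 / real n)"
          using B0 by (intro mult_mono) auto
        then show ?thesis by (simp add: norm_mult)
      qed
    qed (use int in auto)
    finally show ?thesis by (simp add: trig.prob_space)
  qed
  have "(\<lambda>n. T n f x - f x) \<longlonglongrightarrow> 0"
  proof (rule Lim_null_comparison)
    show "\<forall>\<^sub>F n in sequentially. norm (T n f x - f x) \<le> (2 * B * (4 / c\<^sup>2)) / real n"
      using eventually_gt_at_top[of 0] by (rule eventually_mono) (rule le)
    show "(\<lambda>n. (2 * B * (4 / c\<^sup>2)) / real n) \<longlonglongrightarrow> 0" by (rule lim_const_over_n)
  qed
  then show ?thesis by (simp add: LIM_zero_iff)
qed

text \<open>Half-lines generate the Borel sets. The indicator of \<open>{..a}\<close> is locally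
  constant off \<open>a\<close>, and \<open>a\<close> and the two endpoints form a null set.\<close>

lemma trig_summable_indicator_borel:
  assumes "A \<in> sets borel"
  shows "summable_in_Lp (indicator A)"
proof (rule summable_in_Lp_indicator_sigma_sets)
  have meas: "(indicator A :: real \<Rightarrow> complex) \<in> borel_measurable trig_measure"
    if "A \<in> sets borel" for A
    using that by (intro borel_measurable_trig) simp
  have eq: "sets borel = sigma_sets UNIV (range (\<lambda>a::real. {..a}))"
    unfolding borel_eq_atMost by simp
  show "Int_stable (range (\<lambda>a::real. {..a}))"
    by (auto simp: Int_stable_def)
  show "range (\<lambda>a::real. {..a}) \<subseteq> Pow UNIV" by simp
  show "(indicator A :: real \<Rightarrow> complex) \<in> borel_measurable trig_measure"
    if "A \<in> sigma_sets UNIV (range (\<lambda>a::real. {..a}))" for A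
    using that unfolding eq[symmetric] by (rule meas)
  show "A \<in> sigma_sets UNIV (range (\<lambda>a::real. {..a}))" using assms eq by simp
  have AE: "AE x in trig_measure. x \<noteq> -pi \<and> x \<noteq> pi \<and> x \<noteq> a" for a
    by (intro AE_trig_measure AE_conjI AE_lborel_singleton)
  show "summable_in_Lp (indicator UNIV)"
  proof (rule summable_in_Lp_pointwise[OF meas, of _ 1])
    show "AE x in trig_measure. (\<lambda>n. T n (indicator UNIV) x) \<longlonglongrightarrow> indicator UNIV x"
      using AE AE_space
      by eventually_elim
         (rule trig_T_tendsto_if_locally_constant[OF meas, of _ 1 _ 1],
          auto simp: space_trig_measure less_le)
  qed auto
  fix A assume "A \<in> range (\<lambda>a::real. {..a})"
  then obtain a where A: "A = {..a}" by blast
  show "summable_in_Lp (indicator A)"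
  proof (rule summable_in_Lp_pointwise[OF meas, of _ 1])
    \<comment> \<open>The radius of constancy around \<open>x\<close> is its distance to the jump at
      \<open>a\<close>.\<close>
    show "AE x in trig_measure. (\<lambda>n. T n (indicator A) x) \<longlonglongrightarrow> indicator A x"
      using AE[of a] AE_space
      by eventually_elim
         (rule trig_T_tendsto_if_locally_constant[OF meas, of _ 1 _ "\<bar>_ - a\<bar>"],
          auto simp: A space_trig_measure less_le indicator_def)
  qed (auto simp: A indicator_def)
qed

text \<open>A Lebesgue set is a Borel set up to a subset of a null set, which changes its indicator
  only on a null set.\<close>

lemma trig_summable_indicator:
  assumes A: "A \<in> sets trig_measure"
  shows "summable_in_Lp (indicator A)"
proof -
  have "A \<in> sets lebesgue" using A by (auto simp: sets_trig_measure sets_restrict_space)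
  then obtain S N N' where S: "A = S \<union> N" "N \<subseteq> N'" "N' \<in> null_sets lborel" "S \<in> sets lborel"
    by (rule sets_completionE)
  show ?thesis
  proof (rule summable_in_Lp_cong_AE[OF trig_summable_indicator_borel])
    show "S \<in> sets borel" using S by simp
    show "indicator A \<in> borel_measurable trig_measure" using A by simp
    show "AE x in trig_measure. indicator S x = indicator A x"
      using AE_trig_measure[OF AE_not_in[OF S(3)]]
      by eventually_elim (use S in \<open>auto simp: indicator_def\<close>)
  qed
qed

theorem trig_sigma_Lp_tendsto:
  assumes "f \<in> Lp trig_measure p"
  shows "(\<lambda>n. Lp_norm trig_measure p (\<lambda>x. trig_sigma n f x - f x)) \<longlonglongrightarrow> 0"
  by (rule cesaro_Lp_norm_tendsto_0[OF trig_summable_indicator assms])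
     (simp_all add: trig_sigma_def trig_S_def trig_coeff_def exp_cnj)

end

theorem corollary1:
  fixes p :: real
  assumes "1 \<le> p"
  shows "(\<forall>(m :: nat \<Rightarrow> nat) (f :: (nat \<Rightarrow> nat) \<Rightarrow> complex).
            (\<forall>k. 2 \<le> m k) \<and> bdd_above (range m) \<and> f \<in> Lp (vilenkin_measure m) p \<longrightarrow>
            (\<lambda>n. Lp_norm (vilenkin_measure m) p (\<lambda>x. vilenkin_sigma m n f x - f x))
              \<longlonglongrightarrow> 0)
       \<and> (\<forall>f :: real \<Rightarrow> complex. f \<in> Lp trig_measure p \<longrightarrow>
            (\<lambda>n. Lp_norm trig_measure p (\<lambda>x. trig_sigma n f x - f x)) \<longlonglongrightarrow> 0)"
proof (intro conjI allI impI)
  fix m :: "nat \<Rightarrow> nat" and f :: "(nat \<Rightarrow> nat) \<Rightarrow> complex"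
  assume *: "(\<forall>k. 2 \<le> m k) \<and> bdd_above (range m) \<and> f \<in> Lp (vilenkin_measure m) p"
  then interpret vilenkin m by unfold_locales auto
  from * obtain b where "\<And>k. m k \<le> b" by (auto simp: bdd_above_def)
  with * assms show "(\<lambda>n. Lp_norm (vilenkin_measure m) p (\<lambda>x. vilenkin_sigma m n f x - f x))
      \<longlonglongrightarrow> 0"
    by (intro vilenkin_sigma_Lp_tendsto) auto
next
  fix f :: "real \<Rightarrow> complex"
  assume "f \<in> Lp trig_measure p"
  with assms show "(\<lambda>n. Lp_norm trig_measure p (\<lambda>x. trig_sigma n f x - f x)) \<longlonglongrightarrow> 0"
    by (rule trig_sigma_Lp_tendsto)
qed

end
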